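(* Let $V$ be an $n$-dimensional vector space over a field $F$, let $n\ge 3$, $1\le k\le n-1$ and $n\ne 2k$. Then every regular bijection of $\mathbb{G}_k(V)$ onto $\mathbb{G}_{n-k}(V)$ is defined by a non-degenerate sesquilinear form on $V$, i.e. it equals $f_{k\,n-k}(\Omega)$ for some non-degenerate sesquilinear form $\Omega$ on $V$.
   Context: $\mathbb{G}_m(V)$ is the set of all $m$-dimensional linear subspaces of $V$. A set $\mathcal{R}\subset\mathbb{G}_m(V)$ is an $R$-set if there is a basis of $V$ such that every element of $\mathcal{R}$ contains $m$ vectors of this basis (i.e. is spanned by $m$ of the basis vectors). A bijection $f:\mathbb{G}_k(V)\to\mathbb{G}_{n-k}(V)$ is regular if both $f$ and $f^{-1}$ map every $R$-set to an $R$-set. A sesquilinear form on $V$ is a map $\Omega:V\times V\to F$, additive in each variable, with $\Omega(ax,by)=a\,\varphi(b)\,\Omega(x,y)$ for some automorphism $\varphi$ of $F$. For non-degenerate $\Omega$, $f_{k\,n-k}(\Omega):\mathbb{G}_k(V)\to\mathbb{G}_{n-k}(V)$ is the bijection sending $U$ to its $\Omega$-orthogonal complement $\{y\in V:\Omega(x,y)=0\ \forall x\in U\}$. *)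

theory Defs
  imports Main "HOL.Vector_Spaces"
begin

definition field_automorphism :: "('a::field \<Rightarrow> 'a) \<Rightarrow> bool" where
  "field_automorphism \<phi> \<longleftrightarrow>
     bij \<phi> \<and> (\<forall>a b. \<phi> (a + b) = \<phi> a + \<phi> b) \<and> (\<forall>a b. \<phi> (a * b) = \<phi> a * \<phi> b) \<and> \<phi> 1 = 1"

context vector_space
begin

text \<open>The vector space is the whole type \<open>'b\<close>. The library sets \<open>dim U = 0\<close> when \<open>U\<close> has no
  finite basis, so the following is the Grassmannian for \<open>m > 0\<close>, and for \<open>m = 0\<close> as well
  when the space is finite-dimensional.\<close>

definition grassmannian :: "nat \<Rightarrow> 'b set set" where
  "grassmannian m = {U. subspace U \<and> dim U = m}"

definition R_set :: "nat \<Rightarrow> 'b set set \<Rightarrow> bool" where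
  "R_set m R \<longleftrightarrow> R \<subseteq> grassmannian m \<and>
     (\<exists>B. independent B \<and> span B = UNIV \<and>
          (\<forall>U\<in>R. \<exists>S. S \<subseteq> B \<and> finite S \<and> card S = m \<and> S \<subseteq> U))"

definition regular_bijection :: "nat \<Rightarrow> nat \<Rightarrow> ('b set \<Rightarrow> 'b set) \<Rightarrow> bool" where
  "regular_bijection k l f \<longleftrightarrow>
     bij_betw f (grassmannian k) (grassmannian l) \<and>
     (\<forall>R. R_set k R \<longrightarrow> R_set l (f ` R)) \<and>
     (\<forall>R. R_set l R \<longrightarrow> R_set k (inv_into (grassmannian k) f ` R))"

definition sesquilinear_form :: "('b \<Rightarrow> 'b \<Rightarrow> 'a) \<Rightarrow> bool" where
  "sesquilinear_form \<Omega> \<longleftrightarrow>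
     (\<forall>x y z. \<Omega> (x + y) z = \<Omega> x z + \<Omega> y z) \<and>
     (\<forall>x y z. \<Omega> x (y + z) = \<Omega> x y + \<Omega> x z) \<and>
     (\<exists>\<phi>. field_automorphism \<phi> \<and>
          (\<forall>a b x y. \<Omega> (scale a x) (scale b y) = a * \<phi> b * \<Omega> x y))"

end

definition nondegenerate_form :: "('b::zero \<Rightarrow> 'b \<Rightarrow> 'a::zero) \<Rightarrow> bool" where
  "nondegenerate_form \<Omega> \<longleftrightarrow>
     (\<forall>x. (\<forall>y. \<Omega> x y = 0) \<longrightarrow> x = 0) \<and> (\<forall>y. (\<forall>x. \<Omega> x y = 0) \<longrightarrow> y = 0)"

definition orthogonal_complement :: "('b \<Rightarrow> 'b \<Rightarrow> 'a::zero) \<Rightarrow> 'b set \<Rightarrow> 'b set" where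
  "orthogonal_complement \<Omega> U = {y. \<forall>x\<in>U. \<Omega> x y = 0}"

end

theory Submission
  imports Defs "HOL-Library.Function_Algebras" "HOL.Binomial_Plus"
begin

text \<open>A set of coordinate \<open>k\<close>-subspaces of a basis \<open>B\<close> also belongs to an essentially different
  basis iff, for some \<open>i \<noteq> j\<close> in \<open>B\<close>, none of its members contains \<open>i\<close> but not \<open>j\<close>. So \<open>f\<close>, which
  maps the coordinate subspaces of \<open>B\<close> onto those of some basis \<open>B'\<close>, permutes these separating
  families; since \<open>n \<noteq> 2k\<close>, the sizes of their pairwise intersections force
  \<open>f (span A) = span (B' - \<sigma> ` A)\<close> for a bijection \<open>\<sigma> : B \<rightarrow> B'\<close>. For \<open>2k < n\<close> the hyperplane
  \<open>span (B' - {\<sigma> b})\<close> depends only on \<open>b\<close>, as bases can be changed one vector at a time. The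
  resulting map from points to hyperplanes preserves lines, and the fundamental theorem of
  projective geometry makes it semilinear. The case \<open>2k > n\<close> follows by passing to the inverse
  of \<open>f\<close> and transposing the form.\<close>

section \<open>The fundamental theorem of projective geometry\<close>

text \<open>The count behind the permutation: two separating families of k-subsets with the same
  first index and different second indices meet in \<open>(n - 3) choose (k - 1)\<close> sets, and
  those with the same second index and different first indices in
  \<open>(n - 3) choose (k - 2)\<close>. Replacing k by n - k interchanges the two numbers, and they
  differ exactly when n \<noteq> 2k. Two later points hinge on regularity of the inverse, because it
  allows a basis to be prescribed on the target side. For k \<ge> 2 the points of a line lie in
  common k-subspaces, but for k = 1 the map \<open>f\<close> sees single points only, and
  collinearity has to be recovered from bases of hyperplanes. Moreover, a field can have
  endomorphisms that are not onto, so surjectivity of the field map needs an argument of its own: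
  every hyperplane must be the image of a point.\<close>

context vector_space
begin

text \<open>Coefficients are used instead of \<open>independent {x, y}\<close>, since that set
  collapses for x = y and is then independent whenever x is nonzero.\<close>

definition indep2 :: "'b \<Rightarrow> 'b \<Rightarrow> bool" where
  "indep2 x y \<longleftrightarrow> (\<forall>a b. a *s x + b *s y = 0 \<longrightarrow> a = 0 \<and> b = 0)"

definition indep3 :: "'b \<Rightarrow> 'b \<Rightarrow> 'b \<Rightarrow> bool" where
  "indep3 x y z \<longleftrightarrow> (\<forall>a b c. a *s x + b *s y + c *s z = 0 \<longrightarrow> a = 0 \<and> b = 0 \<and> c = 0)"

lemma indep3D:
  assumes "indep3 x y z" "a *s x + b *s y + c *s z = 0"
  shows "a = 0" "b = 0" "c = 0"
  using assms by (auto simp: indep3_def)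

lemma indep3_eqD:
  assumes "indep3 x y z" "a *s x + b *s y + c *s z = a' *s x + b' *s y + c' *s z"
  shows "a = a'" "b = b'" "c = c'"
proof -
  have "(a - a') *s x + (b - b') *s y + (c - c') *s z = 0"
    using assms(2) by (simp add: scale_left_diff_distrib algebra_simps)
  from indep3D[OF assms(1) this] show "a = a'" "b = b'" "c = c'" by simp_all
qed

lemma indep2_sym: "indep2 x y \<Longrightarrow> indep2 y x"
  unfolding indep2_def by (metis add.commute)

lemma indep3_indep2: "indep3 x y z \<Longrightarrow> indep2 y z"
  unfolding indep2_def using indep3D[of x y z 0] by auto

lemma indep2_nonzero: "indep2 x y \<Longrightarrow> x \<noteq> 0" "indep2 x y \<Longrightarrow> y \<noteq> 0"
  unfolding indep2_def
  by (metis add_0_right scale_zero_left scale_zero_right zero_neq_one)+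

lemma indep3_nonzero:
  assumes "indep3 x y z"
  shows "x \<noteq> 0" "y \<noteq> 0" "z \<noteq> 0"
  using indep3D[OF assms, of 1 0 0] indep3D[OF assms, of 0 1 0] indep3D[OF assms, of 0 0 1] by auto

lemma not_indep2E:
  assumes "\<not> indep2 x y" "x \<noteq> 0"
  obtains c where "y = c *s x"
proof -
  obtain a b where ab: "a *s x + b *s y = 0" "a \<noteq> 0 \<or> b \<noteq> 0"
    using assms(1) by (auto simp: indep2_def)
  have "b \<noteq> 0" using ab assms(2) by auto
  have "b *s y = (- a) *s x" using ab(1) by (simp add: add_eq_0_iff2)
  then have "inverse b *s (b *s y) = inverse b *s ((- a) *s x)" by simp
  then have "y = (inverse b * (- a)) *s x" using \<open>b \<noteq> 0\<close> by (simp del: scale_minus_left mult_minus_right)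
  then show ?thesis using that by blast
qed

lemma indep2_iff: "indep2 x y \<longleftrightarrow> x \<noteq> 0 \<and> (\<forall>c. y \<noteq> c *s x)"
proof
  assume i: "indep2 x y"
  have "y \<noteq> c *s x" for c
  proof
    assume "y = c *s x"
    then have "c *s x + (- 1) *s y = 0" by simp
    then have "(- 1 :: 'a) = 0" using i unfolding indep2_def by blast
    then show False by simp
  qed
  then show "x \<noteq> 0 \<and> (\<forall>c. y \<noteq> c *s x)" using i indep2_nonzero by blast
next
  assume "x \<noteq> 0 \<and> (\<forall>c. y \<noteq> c *s x)"
  then show "indep2 x y" using not_indep2E by metis
qed

lemma not_indep3E:
  assumes "\<not> indep3 x y z" "indep2 x y"
  obtains a b where "z = a *s x + b *s y"
proof -
  obtain a b c where abc: "a *s x + b *s y + c *s z = 0" "a \<noteq> 0 \<or> b \<noteq> 0 \<or> c \<noteq> 0"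
    using assms(1) by (auto simp: indep3_def)
  have "c \<noteq> 0"
  proof
    assume "c = 0"
    then show False using abc assms(2) by (auto simp: indep2_def)
  qed
  have "c *s z = - (a *s x + b *s y)" using abc(1) by (simp add: add_eq_0_iff2 eq_neg_iff_add_eq_0 add.commute)
  then have "inverse c *s (c *s z) = inverse c *s ((-a) *s x + (-b) *s y)" by simp
  then have "z = (inverse c * (-a)) *s x + (inverse c * (-b)) *s y" using \<open>c \<noteq> 0\<close>
    by (simp del: scale_minus_left mult_minus_right add: scale_right_distrib)
  then show ?thesis using that by blast
qed

end

locale projective_collineation = vector_space_pair s1 s2
  for s1 :: "'a::field \<Rightarrow> 'b::ab_group_add \<Rightarrow> 'b" (infixr \<open>*a\<close> 75)
  and s2 :: "'a \<Rightarrow> 'c::ab_group_add \<Rightarrow> 'c" (infixr \<open>*b\<close> 75) +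
  fixes p :: "'b \<Rightarrow> 'c"
  assumes line: "\<And>x y a b. x \<noteq> 0 \<Longrightarrow> y \<noteq> 0 \<Longrightarrow> a *a x + b *a y \<noteq> 0 \<Longrightarrow>
      \<exists>c d. p (a *a x + b *a y) = c *b p x + d *b p y"
    and indep: "\<And>x y z. vs1.indep3 x y z \<Longrightarrow> vs2.indep3 (p x) (p y) (p z)"
    and onto: "\<And>x y c. vs1.indep2 x y \<Longrightarrow>
      \<exists>z d. z \<noteq> 0 \<and> p x + c *b p y = d *b p z"
    and ex_indep2: "\<And>x. x \<noteq> 0 \<Longrightarrow> \<exists>y. vs1.indep2 x y"
    and ex_indep3: "\<And>x y. vs1.indep2 x y \<Longrightarrow> \<exists>z. vs1.indep3 x y z"
begin

lemma p_indep2: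
  assumes "vs1.indep2 x y" shows "vs2.indep2 (p x) (p y)"
proof -
  obtain z where "vs1.indep3 x y z" using ex_indep3 assms by blast
  then have "vs2.indep3 (p x) (p y) (p z)" by (rule indep)
  then show ?thesis using vs2.indep3D[where c=0] unfolding vs2.indep2_def
    by (metis add.right_neutral vs2.scale_zero_left)
qed

lemma p_nonzero: "x \<noteq> 0 \<Longrightarrow> p x \<noteq> 0"
  using ex_indep2 p_indep2 vs2.indep2_nonzero by blast

lemma p_scale:
  assumes "a \<noteq> 0" "x \<noteq> 0"
  obtains c where "c \<noteq> 0" "p (a *a x) = c *b p x"
proof -
  obtain c d where "p (a *a x + 0 *a x) = c *b p x + d *b p x"
    using line[of x x a 0] assms by auto
  then have "p (a *a x) = (c + d) *b p x" by (simp add: vs2.scale_left_distrib)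
  moreover have "p (a *a x) \<noteq> 0" using p_nonzero assms by simp
  ultimately show ?thesis using that by force
qed

text \<open>The representatives are rescaled by means of an affine chart. \<open>X\<close> is a
  hyperplane complementary to \<open>e\<close>, and \<open>nu x\<close> is a multiple of
  \<open>p x\<close> chosen so that \<open>l + nu x\<close> represents the image of
  \<open>e + x\<close>. This choice makes \<open>nu\<close> additive, its behaviour under scalars
  defines \<open>\<phi>\<close>, and \<open>\<mu>\<close> extends it to the whole space by sending
  \<open>e\<close> to \<open>l\<close>.\<close>

theorem semilinear_lift:
  assumes e: "(e :: 'b) \<noteq> 0"
  obtains \<mu> \<phi> where "field_automorphism \<phi>"
    "\<And>x y. \<mu> (x + y) = \<mu> x + \<mu> y" "\<And>a x. \<mu> (a *a x) = \<phi> a *b \<mu> x"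
    "\<And>x. x \<noteq> 0 \<Longrightarrow> \<exists>c. c \<noteq> 0 \<and> \<mu> x = c *b p x"
proof -
  define E where "E = vs1.extend_basis {e}"
  have ind_e: "vs1.independent {e}" using e by simp
  have E: "vs1.independent E" "vs1.span E = UNIV" "e \<in> E"
    using vs1.independent_extend_basis[OF ind_e] vs1.span_extend_basis[OF ind_e]
      vs1.extend_basis_superset[OF ind_e] by (auto simp: E_def)
  define \<pi> where "\<pi> v = vs1.representation E v e" for v
  have pi_add: "\<pi> (x + y) = \<pi> x + \<pi> y" for x y
    unfolding \<pi>_def by (subst vs1.representation_add) (use E in auto)
  have pi_scale: "\<pi> (a *a x) = a * \<pi> x" for a x
    unfolding \<pi>_def by (subst vs1.representation_scale) (use E in auto)
  have pi_e: "\<pi> e = 1"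
    unfolding \<pi>_def using vs1.representation_basis[OF E(1) E(3)] by simp
  have pi_diff: "\<pi> (x - y) = \<pi> x - \<pi> y" for x y
    using pi_add[of "x - y" y] by simp
  define l where "l = p e"
  define X where "X = {x. \<pi> x = 0}"
  have X_add: "x + y \<in> X" if "x \<in> X" "y \<in> X" for x y using that by (simp add: X_def pi_add)
  have X_scale: "a *a x \<in> X" if "x \<in> X" for a x using that by (simp add: X_def pi_scale)
  have X_proj: "v - \<pi> v *a e \<in> X" for v by (simp add: X_def pi_diff pi_scale pi_e)
  have eX: "vs1.indep3 e x y" if "x \<in> X" "y \<in> X" "vs1.indep2 x y" for x y
    unfolding vs1.indep3_def
  proof (intro allI impI)
    fix a b c assume s: "a *a e + b *a x + c *a y = 0"
    have "\<pi> (a *a e + b *a x + c *a y) = a" using that(1,2) by (simp add: pi_add pi_scale pi_e X_def)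
    moreover have "\<pi> 0 = 0" using pi_scale[of 0 0] by simp
    ultimately have "a = 0" using s by simp
    with s that(3) show "a = 0 \<and> b = 0 \<and> c = 0" by (auto simp: vs1.indep2_def)
  qed
  have ex1: "vs1.indep2 e x" if "x \<in> X" "x \<noteq> 0" for x
    unfolding vs1.indep2_iff
  proof (intro conjI allI notI)
    fix c assume "x = c *a e"
    then have "c = 0" using that(1) by (simp add: X_def pi_scale pi_e)
    then show False using \<open>x = c *a e\<close> that by simp
  qed (use e in auto)
  have exX: "\<exists>z\<in>X. vs1.indep2 x z" if x: "x \<in> X" "x \<noteq> 0" for x
  proof -
    obtain z where z: "vs1.indep3 e x z" using ex_indep3 ex1 x by blast
    have "vs1.indep2 x (z - \<pi> z *a e)"
      unfolding vs1.indep2_def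
    proof (intro allI impI)
      fix a b assume "a *a x + b *a (z - \<pi> z *a e) = 0"
      then have "(- b * \<pi> z) *a e + a *a x + b *a z = 0"
        by (simp add: vs1.scale_right_diff_distrib algebra_simps)
      from vs1.indep3D[OF z this] show "a = 0 \<and> b = 0" by simp
    qed
    then show ?thesis using X_proj by blast
  qed

  have ex_nu: "\<exists>m c d. m = c *b p x \<and> c \<noteq> 0 \<and> d \<noteq> 0 \<and> l + m = d *b p (e + x)"
    if x: "x \<in> X" "x \<noteq> 0" for x
  proof -
    have ne: "e + x \<noteq> 0"
    proof
      assume "e + x = 0"
      then have "\<pi> (e + x) = 0" using pi_scale[of 0 0] by simp
      then show False using x by (simp add: pi_add pi_e X_def)
    qed
    obtain a b where ab: "p (e + x) = a *b l + b *b p x"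
      using line[of e x 1 1] e x ne by (auto simp: l_def)
    have i1: "vs1.indep2 (e + x) x" unfolding vs1.indep2_def
    proof (intro allI impI)
      fix a b assume "a *a (e + x) + b *a x = 0"
      then have "a *a e + (a + b) *a x = 0"
        by (simp add: vs1.scale_right_distrib vs1.scale_left_distrib add.assoc)
      then have "a = 0" "a + b = 0" using ex1[OF x] by (auto simp: vs1.indep2_def)
      then show "a = 0 \<and> b = 0" by simp
    qed
    have i2: "vs1.indep2 e (e + x)" unfolding vs1.indep2_def
    proof (intro allI impI)
      fix a b assume "a *a e + b *a (e + x) = 0"
      then have "(a + b) *a e + b *a x = 0"
        by (simp add: vs1.scale_right_distrib vs1.scale_left_distrib add.assoc)
      then have "b = 0" "a + b = 0" using ex1[OF x] by (auto simp: vs1.indep2_def)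
      then show "a = 0 \<and> b = 0" by simp
    qed
    \<comment> \<open>\<open>e + x\<close> is independent of \<open>x\<close> and of
      \<open>e\<close>, hence its image is proportional neither to \<open>p x\<close> nor to
      \<open>l\<close>, and both coefficients are nonzero.\<close>
    have "a \<noteq> 0" using p_indep2[OF i1] p_indep2[OF vs1.indep2_sym[OF i1]] ab
      by (auto simp: vs2.indep2_iff)
    moreover have "b \<noteq> 0" using p_indep2[OF i2] ab by (auto simp: vs2.indep2_iff l_def)
    moreover have "l + (b / a) *b p x = (1 / a) *b p (e + x)"
      using \<open>a \<noteq> 0\<close> by (simp add: ab vs2.scale_right_distrib)
    ultimately show ?thesis by (intro exI[of _ "(b/a) *b p x"] exI[of _ "b/a"] exI[of _ "1/a"]) auto
  qed
  define nu where "nu x = (if x = 0 then 0 else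
    (SOME m. \<exists>c d. m = c *b p x \<and> c \<noteq> 0 \<and> d \<noteq> 0 \<and> l + m = d *b p (e + x)))" for x
  have nu0: "nu 0 = 0" by (simp add: nu_def)
  have nu: "\<exists>c d. nu x = c *b p x \<and> c \<noteq> 0 \<and> d \<noteq> 0 \<and> l + nu x = d *b p (e + x)"
    if x: "x \<in> X" "x \<noteq> 0" for x
    using someI_ex[OF ex_nu[OF x]] x(2) by (simp add: nu_def)
  have nu_p: "\<exists>c. c \<noteq> 0 \<and> nu x = c *b p x" if "x \<in> X" "x \<noteq> 0" for x using nu[OF that] by blast
  have p_nu: "\<exists>c. c \<noteq> 0 \<and> p x = c *b nu x" if x: "x \<in> X" "x \<noteq> 0" for x
  proof -
    obtain c where "c \<noteq> 0" "nu x = c *b p x" using nu_p x by blast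
    then show ?thesis by (intro exI[of _ "inverse c"]) auto
  qed
  have p_e_nu: "\<exists>c. c \<noteq> 0 \<and> p (e + x) = c *b (l + nu x)" if x: "x \<in> X" for x
  proof (cases "x = 0")
    case True then show ?thesis by (intro exI[of _ 1]) (simp add: nu0 l_def)
  next
    case False
    obtain d where "d \<noteq> 0" "l + nu x = d *b p (e + x)" using nu x False by blast
    then show ?thesis by (intro exI[of _ "inverse d"]) auto
  qed
  have nu_ne: "nu x \<noteq> 0" if "x \<in> X" "x \<noteq> 0" for x
    using nu_p[OF that] p_nonzero[OF that(2)] by auto
  have nu_indep: "vs2.indep3 l (nu x) (nu y)" if xy: "x \<in> X" "y \<in> X" "vs1.indep2 x y" for x y
  proof -
    obtain c d where cd: "c \<noteq> 0" "nu x = c *b p x" "d \<noteq> 0" "nu y = d *b p y"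
      using nu_p xy vs1.indep2_nonzero[OF xy(3)] by metis
    have "vs2.indep3 l (p x) (p y)" unfolding l_def by (rule indep[OF eX[OF xy]])
    show ?thesis unfolding vs2.indep3_def
    proof (intro allI impI)
      fix a b r assume "a *b l + b *b nu x + r *b nu y = 0"
      then have "a *b l + (b * c) *b p x + (r * d) *b p y = 0" using cd by simp
      from vs2.indep3D[OF \<open>vs2.indep3 l (p x) (p y)\<close> this]
      show "a = 0 \<and> b = 0 \<and> r = 0" using cd by simp
    qed
  qed
  have add1: "nu (x + y) = nu x + nu y" if xy: "x \<in> X" "y \<in> X" "vs1.indep2 x y" for x y
  proof -
    note I = nu_indep[OF xy]
    have nz: "x \<noteq> 0" "y \<noteq> 0" using vs1.indep2_nonzero xy by blast+
    have nexy: "x + y \<noteq> 0" using xy(3) unfolding vs1.indep2_def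
      by (metis vs1.scale_one zero_neq_one)
    have e_ne: "e + v \<noteq> 0" if "v \<in> X" for v
    proof
      assume "e + v = 0"
      then have "\<pi> (e + v) = 0" using pi_scale[of 0 0] by simp
      then show False using that by (simp add: pi_add pi_e X_def)
    qed
    have key: "\<exists>a b. p (e + (x + y)) = a *b (l + nu x) + b *b nu y"
      if xy: "x \<in> X" "y \<in> X" and "y \<noteq> 0" for x y
    proof -
      obtain a b where "p (1 *a (e + x) + 1 *a y) = a *b p (e + x) + b *b p y"
        using line[of "e + x" y 1 1] e_ne[OF xy(1)] e_ne[OF X_add[OF xy]] \<open>y \<noteq> 0\<close>
        by (auto simp: add.assoc)
      moreover obtain c where "p (e + x) = c *b (l + nu x)" using p_e_nu xy by blast
      moreover obtain d where "p y = d *b nu y" using p_nu xy \<open>y \<noteq> 0\<close> by blast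
      ultimately have "p (e + (x + y)) = (a * c) *b (l + nu x) + (b * d) *b nu y"
        by (simp add: add.assoc)
      then show ?thesis by blast
    qed
    \<comment> \<open>The point \<open>e + x + y\<close> lies on the line through
      \<open>e + x\<close> and \<open>y\<close> and on the line through \<open>e + y\<close> and
      \<open>x\<close>. Comparing the two expansions in \<open>l\<close>, \<open>nu x\<close>,
      \<open>nu y\<close> makes all three coefficients equal to \<open>a\<close>.\<close>
    obtain a b where ab: "p (e + (x + y)) = a *b (l + nu x) + b *b nu y"
      using key[of x y] xy nz by blast
    obtain a' b' where ab': "p (e + (x + y)) = a' *b (l + nu y) + b' *b nu x"
      using key[of y x] xy nz by (auto simp: add.commute)
    have "a *b l + a *b nu x + b *b nu y = a' *b l + b' *b nu x + a' *b nu y"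
      using ab ab' by (simp add: vs2.scale_right_distrib add_ac)
    note * = vs2.indep3_eqD[OF I this]
    then have p1: "p (e + (x + y)) = a *b (l + nu x + nu y)"
      using ab by (simp add: vs2.scale_right_distrib)
    \<comment> \<open>A second expansion of the same vector: \<open>nu (x + y)\<close> is a
      combination of \<open>nu x\<close> and \<open>nu y\<close> because \<open>x + y\<close> is on
      their line. Comparison with \<open>p1\<close> shows that both of its coefficients are
      1.\<close>
    obtain t where t: "t \<noteq> 0" "p (e + (x + y)) = t *b (l + nu (x + y))"
      using p_e_nu X_add xy by blast
    obtain r where r: "nu (x + y) = r *b p (x + y)" using nu_p X_add xy nexy by blast
    obtain c d where "p (1 *a x + 1 *a y) = c *b p x + d *b p y"
      using line[of x y 1 1] nz nexy by auto
    moreover obtain u where "p x = u *b nu x" using p_nu xy nz by blast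
    moreover obtain v where "p y = v *b nu y" using p_nu xy nz by blast
    ultimately have n: "nu (x + y) = (r * c * u) *b nu x + (r * d * v) *b nu y"
      using r by (simp add: vs2.scale_right_distrib mult.assoc)
    have "a *b l + a *b nu x + a *b nu y
        = t *b l + (t * (r * c * u)) *b nu x + (t * (r * d * v)) *b nu y"
      using p1 t(2) n by (simp add: vs2.scale_right_distrib add.assoc)
    note ** = vs2.indep3_eqD[OF I this]
    then have "r * c * u = 1" "r * d * v = 1" using t(1) by auto
    then show ?thesis using n by simp
  qed
  have indep_shift: "vs1.indep2 (z + x) y" if "x \<noteq> 0" "vs1.indep2 z x" "y = c *a x" "y \<noteq> 0" for x y z c
    unfolding vs1.indep2_def
  proof (intro allI impI)
    fix a b assume "a *a (z + x) + b *a y = 0"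
    then have "a *a z + (a + b * c) *a x = 0"
      using that(3) by (simp add: vs1.scale_right_distrib vs1.scale_left_distrib add.assoc)
    then have "a = 0" "a + b * c = 0" using that(2) unfolding vs1.indep2_def by blast+
    moreover have "c \<noteq> 0" using that by auto
    ultimately show "a = 0 \<and> b = 0" by simp
  qed
  have nu_add: "nu (x + y) = nu x + nu y" if xy: "x \<in> X" "y \<in> X" for x y
  proof -
    consider "x = 0" | "y = 0" | "vs1.indep2 x y" | "x \<noteq> 0" "y \<noteq> 0" "\<not> vs1.indep2 x y" by blast
    then show ?thesis
    proof cases
      case 4
      \<comment> \<open>For proportional vectors an auxiliary \<open>z\<close> off their line is
        added, and \<open>nu (z + x + y)\<close> is split both as (z + x) + y and as z + (x + y),
        where the summands are independent or x + y = 0.\<close>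
      obtain c where c: "y = c *a x" using vs1.not_indep2E[OF 4(3,1)] .
      obtain z where z: "z \<in> X" "vs1.indep2 x z" using exX xy 4 by blast
      then have zx: "vs1.indep2 z x" using vs1.indep2_sym by blast
      have "nu (z + x + y) = nu z + nu x + nu y"
        using add1[OF X_add[OF z(1) xy(1)] xy(2) indep_shift[OF 4(1) zx c 4(2)]]
          add1[OF z(1) xy(1) zx] by simp
      moreover have "nu (z + (x + y)) = nu z + nu (x + y)"
      proof (cases "x + y = 0")
        case False
        have xy': "x + y = (1 + c) *a x" using c by (simp add: vs1.scale_left_distrib)
        have "vs1.indep2 z (x + y)" unfolding vs1.indep2_def
        proof (intro allI impI)
          fix a b assume "a *a z + b *a (x + y) = 0"
          then have "a *a z + (b * (1 + c)) *a x = 0" by (simp add: xy')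
          then have "a = 0" "b * (1 + c) = 0" using zx unfolding vs1.indep2_def by blast+
          moreover have "1 + c \<noteq> 0" using False xy' by auto
          ultimately show "a = 0 \<and> b = 0" by simp
        qed
        then show ?thesis using add1[OF z(1) X_add[OF xy]] by simp
      qed (simp add: nu0)
      ultimately show ?thesis by (simp add: add.assoc)
    qed (use add1 xy nu0 in auto)
  qed
  have nu_t: "\<exists>t. nu (a *a x) = t *b nu x" if x: "x \<in> X" "x \<noteq> 0" for a x
  proof (cases "a = 0")
    case False
    obtain c where "nu (a *a x) = c *b p (a *a x)" using nu_p[OF X_scale[OF x(1), of a]] False x(2) by auto
    moreover obtain d where "p (a *a x) = d *b p x" using p_scale False x(2) by metis
    moreover obtain u where "p x = u *b nu x" using p_nu x by blast
    ultimately show ?thesis by auto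
  qed (auto simp: nu0 intro: exI[of _ 0])
  have nu_t_eq: "t = s" if xy: "x \<in> X" "y \<in> X" "vs1.indep2 x y"
    and t: "nu (a *a x) = t *b nu x" and s: "nu (a *a y) = s *b nu y" for a t s x y
  proof -
    have nexy: "x + y \<noteq> 0" using xy(3) unfolding vs1.indep2_def
      by (metis vs1.scale_one zero_neq_one)
    \<comment> \<open>The factor \<open>r\<close> belonging to \<open>x + y\<close> has to be the
      factor of \<open>x\<close> and of \<open>y\<close> at the same time.\<close>
    obtain r where "nu (a *a (x + y)) = r *b nu (x + y)" using nu_t[OF X_add[OF xy(1,2)] nexy] by blast
    then have "0 *b l + t *b nu x + s *b nu y = 0 *b l + r *b nu x + r *b nu y"
      using t s xy nu_add X_scale by (simp add: vs1.scale_right_distrib vs2.scale_right_distrib)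
    from vs2.indep3_eqD[OF nu_indep[OF xy] this] show "t = s" by simp
  qed
  obtain u where u: "u \<in> X" "u \<noteq> 0"
  proof -
    obtain y where "vs1.indep2 e y" using ex_indep2 e by blast
    then have "y - \<pi> y *a e \<noteq> 0" by (simp add: vs1.indep2_iff)
    then show ?thesis using that X_proj by blast
  qed
  define \<phi> where "\<phi> a = (SOME t. nu (a *a u) = t *b nu u)" for a
  have phi_u: "nu (a *a u) = \<phi> a *b nu u" for a
    unfolding \<phi>_def by (rule someI_ex) (rule nu_t[OF u])
  have nu_scale: "nu (a *a x) = \<phi> a *b nu x" if x: "x \<in> X" for a x
  proof (cases "x = 0")
    case False
    obtain t where t: "nu (a *a x) = t *b nu x" using nu_t x False by blast
    have "t = \<phi> a"
    proof (cases "vs1.indep2 x u")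
      case True
      then show ?thesis using nu_t_eq[OF x u(1) True t phi_u] by simp
    next
      case F: False
      \<comment> \<open>Proportional vectors cannot be compared directly; both are compared with a
        \<open>z\<close> off their line.\<close>
      obtain c where c: "u = c *a x" using vs1.not_indep2E[OF F False] .
      obtain z where z: "z \<in> X" "vs1.indep2 x z" using exX x False by blast
      obtain s where s: "nu (a *a z) = s *b nu z" using nu_t z vs1.indep2_nonzero by blast
      have c0: "c \<noteq> 0" using c u by auto
      have "vs1.indep2 u z" unfolding vs1.indep2_def
      proof (intro allI impI)
        fix a b assume "a *a u + b *a z = 0"
        then have "(a * c) *a x + b *a z = 0" by (simp add: c)
        then have "a * c = 0" "b = 0" using z(2) unfolding vs1.indep2_def by blast+
        then show "a = 0 \<and> b = 0" using c0 by simp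
      qed
      then have "\<phi> a = s" using nu_t_eq[OF u(1) z(1) _ phi_u s] by blast
      moreover have "t = s" using nu_t_eq[OF x z t s] .
      ultimately show ?thesis by simp
    qed
    then show ?thesis using t by simp
  qed (simp add: nu0)
  have phi_eqI: "s = t" if "s *b nu u = t *b nu u" for s t using that nu_ne[OF u] by simp
  have phi_add: "\<phi> (a + b) = \<phi> a + \<phi> b" for a b
  proof (rule phi_eqI)
    have "\<phi> (a + b) *b nu u = nu (a *a u + b *a u)" by (simp add: phi_u[symmetric] vs1.scale_left_distrib)
    also have "\<dots> = (\<phi> a + \<phi> b) *b nu u" using nu_add X_scale u by (simp add: phi_u vs2.scale_left_distrib)
    finally show "\<phi> (a + b) *b nu u = (\<phi> a + \<phi> b) *b nu u" .
  qed
  have phi_mult: "\<phi> (a * b) = \<phi> a * \<phi> b" for a b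
  proof (rule phi_eqI)
    have "\<phi> (a * b) *b nu u = nu (a *a (b *a u))" by (simp add: phi_u[symmetric])
    also have "\<dots> = (\<phi> a * \<phi> b) *b nu u" using nu_scale[OF X_scale[OF u(1)]] by (simp add: phi_u)
    finally show "\<phi> (a * b) *b nu u = (\<phi> a * \<phi> b) *b nu u" .
  qed
  have phi_1: "\<phi> 1 = 1" by (rule phi_eqI) (simp add: phi_u[symmetric])
  have phi_0: "\<phi> 0 = 0" by (metis add.right_neutral add_left_cancel phi_add)
  have phi_ne: "\<phi> a \<noteq> 0" if "a \<noteq> 0" for a
    using phi_mult[of a "inverse a"] phi_1 that by auto
  have phi_diff: "\<phi> (a - b) = \<phi> a - \<phi> b" for a b
    using phi_add[of "a - b" b] by (simp add: eq_diff_eq)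
  have "inj \<phi>"
  proof (rule injI)
    fix a b assume "\<phi> a = \<phi> b"
    then have "\<phi> (a - b) = 0" by (simp add: phi_diff)
    then show "a = b" using phi_ne[of "a - b"] by auto
  qed
  have "surj \<phi>"
  proof -
    have "\<exists>a. \<phi> a = c" for c
    proof -
      obtain w where w: "w \<in> X" "vs1.indep2 u w" using exX u by blast
      have w0: "w \<noteq> 0" using vs1.indep2_nonzero w by blast
      obtain r where r: "r \<noteq> 0" "nu u = r *b p u" using nu_p u by blast
      obtain s where s: "s \<noteq> 0" "nu w = s *b p w" using nu_p w w0 by blast
      \<comment> \<open>The coefficient \<open>c * s / r\<close> is chosen so that \<open>r\<close>
        times the left-hand side is \<open>nu u + c *b nu w\<close>. By \<open>indep\<close> the
        point \<open>z\<close> lies in the span of \<open>u\<close> and \<open>w\<close>, say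
        \<open>z = a *a u + b *a w\<close>, and then \<open>b / a\<close> is a preimage of
        \<open>c\<close>.\<close>
      obtain z d where zd: "z \<noteq> 0" "p u + (c * s / r) *b p w = d *b p z"
        using onto[OF w(2)] by blast
      have "\<not> vs1.indep3 u w z"
      proof
        assume "vs1.indep3 u w z"
        moreover have "1 *b p u + (c * s / r) *b p w + (- d) *b p z = 0" using zd by simp
        ultimately have "(1::'a) = 0" using indep vs2.indep3D(1) by blast
        then show False by simp
      qed
      then obtain a b where ab: "z = a *a u + b *a w" using vs1.not_indep3E w(2) by blast
      have zX: "z \<in> X" using ab X_add X_scale u w by simp
      obtain t where t: "p z = t *b nu z" using p_nu zX zd by blast
      have "nu u + c *b nu w = r *b (p u + (c * s / r) *b p w)"
        using r s by (simp add: vs2.scale_right_distrib)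
      also have "\<dots> = (r * d * t) *b nu z" using zd t by simp
      also have "\<dots> = (r * d * t * \<phi> a) *b nu u + (r * d * t * \<phi> b) *b nu w"
        using ab u w X_scale by (simp add: nu_add nu_scale vs2.scale_right_distrib)
      finally have "0 *b l + 1 *b nu u + c *b nu w
          = 0 *b l + (r * d * t * \<phi> a) *b nu u + (r * d * t * \<phi> b) *b nu w" by simp
      note * = vs2.indep3_eqD[OF nu_indep[OF u(1) w] this]
      have "a \<noteq> 0" using * phi_0 by auto
      have "\<phi> (b / a) * \<phi> a = \<phi> b" using phi_mult[of "b / a" a] \<open>a \<noteq> 0\<close> by simp
      then have "\<phi> (b / a) = c" using *
        by (metis (no_types, lifting) mult.assoc mult.commute mult.left_neutral)
      then show ?thesis by blast
    qed
    then show ?thesis by (metis surjI)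
  qed
  define \<mu> where "\<mu> v = \<phi> (\<pi> v) *b l + nu (v - \<pi> v *a e)" for v
  show ?thesis
  proof (rule that)
    show "field_automorphism \<phi>" using \<open>inj \<phi>\<close> \<open>surj \<phi>\<close> phi_add phi_mult phi_1
      by (auto simp: field_automorphism_def bij_def)
    show "\<mu> (x + y) = \<mu> x + \<mu> y" for x y
    proof -
      have "x + y - \<pi> (x + y) *a e = (x - \<pi> x *a e) + (y - \<pi> y *a e)"
        by (simp add: pi_add vs1.scale_left_distrib algebra_simps)
      then show ?thesis using nu_add[OF X_proj X_proj]
        by (simp add: \<mu>_def pi_add phi_add vs2.scale_left_distrib algebra_simps)
    qed
    show "\<mu> (a *a x) = \<phi> a *b \<mu> x" for a x
    proof -
      have "a *a x - \<pi> (a *a x) *a e = a *a (x - \<pi> x *a e)"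
        by (simp add: pi_scale vs1.scale_right_diff_distrib)
      then show ?thesis using nu_scale[OF X_proj]
        by (simp add: \<mu>_def pi_scale phi_mult vs2.scale_right_distrib)
    qed
    show "\<exists>c. c \<noteq> 0 \<and> \<mu> x = c *b p x" if "x \<noteq> 0" for x
    proof (cases "\<pi> x = 0")
      case True
      then show ?thesis using nu_p[of x] that by (simp add: \<mu>_def phi_0 X_def)
    next
      case False
      \<comment> \<open>Division by \<open>\<pi> x\<close> moves \<open>x\<close> into the affine
        chart \<open>e + X\<close>, where \<open>p_e_nu\<close> applies.\<close>
      define y where "y = inverse (\<pi> x) *a (x - \<pi> x *a e)"
      have yX: "y \<in> X" unfolding y_def by (intro X_scale X_proj)
      have xy: "x = \<pi> x *a (e + y)" using False
        by (simp add: y_def vs1.scale_right_distrib vs1.scale_right_diff_distrib)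
      have ne: "e + y \<noteq> 0" using xy that by auto
      have "x - \<pi> x *a e = \<pi> x *a y" using False by (simp add: y_def)
      then have "\<mu> x = \<phi> (\<pi> x) *b (l + nu y)" using nu_scale[OF yX]
        by (simp add: \<mu>_def vs2.scale_right_distrib)
      moreover obtain c where c: "c \<noteq> 0" "p (e + y) = c *b (l + nu y)" using p_e_nu yX by blast
      moreover obtain d where d: "d \<noteq> 0" "p (\<pi> x *a (e + y)) = d *b p (e + y)"
        using p_scale[OF False ne] by blast
      ultimately have "\<mu> x = (\<phi> (\<pi> x) / (c * d)) *b p x" using xy by simp
      then show ?thesis using c d phi_ne[OF False] by (intro exI[of _ "\<phi> (\<pi> x) / (c * d)"]) auto
    qed
  qed
qed

end

section \<open>Bijections between sets of subsets\<close>

definition ksubsets :: "nat \<Rightarrow> 'a set \<Rightarrow> 'a set set" where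
  "ksubsets m B = {A. A \<subseteq> B \<and> card A = m}"

definition separating :: "nat \<Rightarrow> 'a set \<Rightarrow> 'a \<Rightarrow> 'a \<Rightarrow> 'a set set" where
  "separating m B i j = {A \<in> ksubsets m B. i \<in> A \<and> j \<notin> A}"

lemma finite_ksubsets: "finite B \<Longrightarrow> finite (ksubsets m B)"
  by (simp add: ksubsets_def)

lemma finite_separating: "finite B \<Longrightarrow> finite (separating m B i j)"
  by (simp add: separating_def finite_ksubsets)

lemma card_ksubsets: "finite B \<Longrightarrow> card (ksubsets m B) = card B choose m"
  by (simp add: ksubsets_def n_subsets)

lemma ex_ksubset:
  assumes "finite B" "T \<subseteq> B" "D \<subseteq> B - T" "card T \<le> m" "m + card D \<le> card B"
  obtains A where "A \<in> ksubsets m B" "T \<subseteq> A" "A \<inter> D = {}"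
proof -
  have "m \<le> card (B - D)"
    using assms by (subst card_Diff_subset) (auto intro: finite_subset)
  moreover have "T \<subseteq> B - D" using assms by auto
  ultimately obtain A where "T \<subseteq> A" "A \<subseteq> B - D" "card A = m"
    using exists_subset_between[of T m "B - D"] assms by auto
  moreover have "A \<inter> D = {}" using \<open>A \<subseteq> B - D\<close> by blast
  ultimately show ?thesis using that[of A] by (auto simp: ksubsets_def)
qed

lemma card_ksubsets_containing_avoiding:
  assumes "finite B" "i \<in> B" "D \<subseteq> B - {i}" "1 \<le> m"
  shows "card {A \<in> ksubsets m B. i \<in> A \<and> A \<inter> D = {}} = (card B - 1 - card D) choose (m - 1)"
proof -
  let ?E = "B - {i} - D"
  have finE: "finite ?E" using assms by simp
  have "bij_betw (insert i) (ksubsets (m - 1) ?E) {A \<in> ksubsets m B. i \<in> A \<and> A \<inter> D = {}}"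
  proof (rule bij_betw_imageI)
    show "inj_on (insert i) (ksubsets (m - 1) ?E)"
      by (rule inj_onI) (auto simp: ksubsets_def)
    show "insert i ` ksubsets (m - 1) ?E = {A \<in> ksubsets m B. i \<in> A \<and> A \<inter> D = {}}"
    proof (intro equalityI subsetI)
      fix A assume "A \<in> insert i ` ksubsets (m - 1) ?E"
      then obtain C where C: "A = insert i C" "C \<subseteq> ?E" "card C = m - 1" by (auto simp: ksubsets_def)
      moreover have "finite C" using C(2) finE finite_subset by blast
      ultimately show "A \<in> {A \<in> ksubsets m B. i \<in> A \<and> A \<inter> D = {}}"
        using assms by (auto simp: ksubsets_def card_insert_if)
    next
      fix A assume A: "A \<in> {A \<in> ksubsets m B. i \<in> A \<and> A \<inter> D = {}}"
      then have "A - {i} \<in> ksubsets (m - 1) ?E" by (auto simp: ksubsets_def card_Diff_singleton)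
      moreover have "A = insert i (A - {i})" using A by auto
      ultimately show "A \<in> insert i ` ksubsets (m - 1) ?E" by blast
    qed
  qed
  then have "card {A \<in> ksubsets m B. i \<in> A \<and> A \<inter> D = {}} = card (ksubsets (m - 1) ?E)"
    by (simp add: bij_betw_same_card)
  also have "\<dots> = card ?E choose (m - 1)" using finE by (rule card_ksubsets)
  also have "card ?E = card B - 1 - card D"
    using assms by (subst card_Diff_subset) (auto intro: finite_subset simp: card_Diff_singleton)
  finally show ?thesis .
qed

lemma card_separating:
  assumes "finite B" "i \<in> B" "j \<in> B" "i \<noteq> j" "1 \<le> m"
  shows "card (separating m B i j) = (card B - 2) choose (m - 1)"
proof -
  have "separating m B i j = {A \<in> ksubsets m B. i \<in> A \<and> A \<inter> {j} = {}}"
    by (auto simp: separating_def)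
  then show ?thesis
    using card_ksubsets_containing_avoiding[of B i "{j}" m] assms by (simp add: numeral_2_eq_2)
qed

theorem ksubsets_bijection_complement:
  assumes fin: "finite B" "finite B'" and card: "card B = n" "card B' = n"
    and k: "1 \<le> k" "2 * k < n"
    and h: "bij_betw h (ksubsets k B) (ksubsets (n - k) B')"
    and sep: "\<And>i j. i \<in> B \<Longrightarrow> j \<in> B \<Longrightarrow> i \<noteq> j \<Longrightarrow>
      \<exists>i'\<in>B'. \<exists>j'\<in>B'. i' \<noteq> j' \<and> separating (n - k) B' i' j' \<subseteq> h ` separating k B i j"
  obtains \<sigma> where "bij_betw \<sigma> B B'" "\<And>A. A \<in> ksubsets k B \<Longrightarrow> h A = B' - \<sigma> ` A"
proof -
  have inj: "inj_on h (ksubsets k B)" using h by (rule bij_betw_imp_inj_on)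
  have img: "h A \<in> ksubsets (n - k) B'" if "A \<in> ksubsets k B" for A
    using h that by (auto simp: bij_betw_def)
  have sub: "separating k B i j \<subseteq> ksubsets k B" for i j by (auto simp: separating_def)
  have "\<exists>i' j'. i' \<in> B' \<and> j' \<in> B' \<and> i' \<noteq> j' \<and> h ` separating k B i j = separating (n - k) B' i' j'"
    if ij: "i \<in> B" "j \<in> B" "i \<noteq> j" for i j
  proof -
    obtain i' j' where ij': "i' \<in> B'" "j' \<in> B'" "i' \<noteq> j'"
      and s: "separating (n - k) B' i' j' \<subseteq> h ` separating k B i j" using sep[OF ij] by blast
    have "card (separating (n - k) B' i' j') = (n - 2) choose (n - k - 1)"
      using card_separating[OF fin(2) ij', of "n - k"] card k by simp
    also have "\<dots> = (n - 2) choose (n - 2 - (n - k - 1))"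
      by (rule binomial_symmetric) (use k in linarith)
    also have "n - 2 - (n - k - 1) = k - 1" using k by linarith
    also have "(n - 2) choose (k - 1) = card (h ` separating k B i j)"
      using card_separating[OF fin(1) ij k(1)] card card_image[OF inj_on_subset[OF inj sub]] by simp
    finally have "separating (n - k) B' i' j' = h ` separating k B i j"
      using s finite_separating[OF fin(1)] by (intro card_subset_eq) auto
    then show ?thesis using ij' by metis
  qed
  then obtain s t where st: "\<And>i j. i \<in> B \<Longrightarrow> j \<in> B \<Longrightarrow> i \<noteq> j \<Longrightarrow>
      s i j \<in> B' \<and> t i j \<in> B' \<and> s i j \<noteq> t i j \<and> h ` separating k B i j = separating (n - k) B' (s i j) (t i j)"
    by metis
  \<comment> \<open>Here 2k < n enters: k - 1 lies in the range where the binomial coefficients of n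
    - 3 still increase. For k = 1 the symmetry rule is out of range, but the left side is 0 and the
    right side is 1.\<close>
  have less: "(n - 3) choose (n - k - 1) < (n - 3) choose (k - 1)"
  proof (cases "k = 1")
    case False
    have "(n - 3) choose (n - k - 1) = (n - 3) choose (n - 3 - (n - k - 1))"
      by (rule binomial_symmetric) (use k False in linarith)
    also have "n - 3 - (n - k - 1) = k - 2" using k by linarith
    also have "(n - 3) choose (k - 2) < (n - 3) choose (k - 1)"
      by (rule binomial_strict_mono) (use k False in linarith)+
    finally show ?thesis .
  qed (use k in simp)
  have t_eq: "t i j = t i l" if ij: "i \<in> B" "j \<in> B" "l \<in> B" "i \<noteq> j" "i \<noteq> l" for i j l
  proof (rule ccontr)
    assume ne: "t i j \<noteq> t i l"
    then have "j \<noteq> l" by auto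
    let ?P = "separating k B i j \<inter> separating k B i l"
    have "?P = {A \<in> ksubsets k B. i \<in> A \<and> A \<inter> {j, l} = {}}" by (auto simp: separating_def)
    then have P: "card ?P = (n - 3) choose (k - 1)"
      using card_ksubsets_containing_avoiding[OF fin(1) ij(1), of "{j, l}" k] ij \<open>j \<noteq> l\<close> k card
      by (simp add: numeral_3_eq_3)
    \<comment> \<open>If the second indices differed, the image of the intersection would have to
      avoid both of them and would be too small.\<close>
    let ?Q = "{A \<in> ksubsets (n - k) B'. s i j \<in> A \<and> A \<inter> {t i j, t i l} = {}}"
    have "h ` ?P = h ` separating k B i j \<inter> h ` separating k B i l"
      by (rule inj_on_image_Int[OF inj sub sub])
    then have hP: "h ` ?P \<subseteq> ?Q" using st[of i j] st[of i l] ij by (auto simp: separating_def)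
    have "card ?Q \<le> (n - 3) choose (n - k - 1)"
    proof (cases "t i l = s i j")
      case True
      then have "?Q = {}" by auto
      then show ?thesis by (metis card.empty le0)
    next
      case False
      have "t i j \<noteq> s i j" "1 \<le> n - k" using st[of i j] ij k by auto
      with False show ?thesis
        using card_ksubsets_containing_avoiding[OF fin(2), of "s i j" "{t i j, t i l}" "n - k"]
          st[of i j] st[of i l] ij ne card by (simp add: numeral_3_eq_3)
    qed
    moreover have "card (h ` ?P) = card ?P"
      by (rule card_image, rule inj_on_subset[OF inj]) (auto simp: separating_def)
    moreover have "card (h ` ?P) \<le> card ?Q"
      by (rule card_mono[OF _ hP]) (simp add: finite_ksubsets fin)
    ultimately show False using P less by linarith
  qed
  have ex_other: "\<exists>j\<in>B. j \<noteq> i" for i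
  proof (rule ccontr)
    assume "\<not> (\<exists>j\<in>B. j \<noteq> i)"
    then have "B \<subseteq> {i}" by blast
    then have "card B \<le> 1" using card_mono[of "{i}" B] by simp
    then show False using card k by simp
  qed
  define \<sigma> where "\<sigma> i = t i (SOME j. j \<in> B \<and> j \<noteq> i)" for i
  have sig: "\<sigma> i = t i j" if "i \<in> B" "j \<in> B" "i \<noteq> j" for i j
  proof -
    have "(SOME j. j \<in> B \<and> j \<noteq> i) \<in> B \<and> (SOME j. j \<in> B \<and> j \<noteq> i) \<noteq> i"
      by (rule someI_ex) (use ex_other[of i] in blast)
    then show ?thesis unfolding \<sigma>_def using t_eq that by metis
  qed
  have sig_in: "\<sigma> i \<in> B'" if "i \<in> B" for i
    using ex_other[of i] sig st that by metis
  have avoid: "\<sigma> i \<notin> h A" if A: "A \<in> ksubsets k B" and i: "i \<in> A" for A i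
  proof -
    have "A \<noteq> B" using A card k by (auto simp: ksubsets_def)
    then obtain j where j: "j \<in> B" "j \<notin> A" using A by (auto simp: ksubsets_def)
    have iB: "i \<in> B" using A i by (auto simp: ksubsets_def)
    have ne: "i \<noteq> j" using i j by blast
    have "h A \<in> h ` separating k B i j" using A i j by (auto simp: separating_def)
    then have "h A \<in> separating (n - k) B' (s i j) (t i j)" using st[OF iB j(1) ne] by simp
    then show ?thesis using sig[OF iB j(1) ne] by (simp add: separating_def)
  qed
  \<comment> \<open>Equality holds since \<open>(n - 1) choose (k - 1)\<close> equals
    \<open>(n - 1) choose (n - k)\<close>. It yields injectivity of \<open>\<sigma>\<close>: if
    \<open>\<sigma> i = \<sigma> j\<close>, then the same k-subsets would contain \<open>i\<close>
    as contain \<open>j\<close>.\<close>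
  have stars: "h ` {A \<in> ksubsets k B. i \<in> A} = ksubsets (n - k) (B' - {\<sigma> i})" if i: "i \<in> B" for i
  proof (rule card_subset_eq)
    show "finite (ksubsets (n - k) (B' - {\<sigma> i}))" by (simp add: finite_ksubsets fin)
    show "h ` {A \<in> ksubsets k B. i \<in> A} \<subseteq> ksubsets (n - k) (B' - {\<sigma> i})"
    proof
      fix C assume "C \<in> h ` {A \<in> ksubsets k B. i \<in> A}"
      then obtain A where A: "A \<in> ksubsets k B" "i \<in> A" "C = h A" by blast
      show "C \<in> ksubsets (n - k) (B' - {\<sigma> i})"
        using img[OF A(1)] avoid[OF A(1,2)] A(3) by (auto simp: ksubsets_def)
    qed
    have "card (h ` {A \<in> ksubsets k B. i \<in> A}) = card {A \<in> ksubsets k B. i \<in> A}"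
      by (rule card_image, rule inj_on_subset[OF inj]) auto
    also have "\<dots> = (n - 1) choose (k - 1)"
      using card_ksubsets_containing_avoiding[OF fin(1) i, of "{}" k] k card by simp
    also have "\<dots> = (n - 1) choose (n - 1 - (k - 1))" by (rule binomial_symmetric) (use k in linarith)
    also have "n - 1 - (k - 1) = n - k" using k by linarith
    also have "(n - 1) choose (n - k) = card (ksubsets (n - k) (B' - {\<sigma> i}))"
      using fin card sig_in[OF i] by (simp add: card_ksubsets)
    finally show "card (h ` {A \<in> ksubsets k B. i \<in> A}) = card (ksubsets (n - k) (B' - {\<sigma> i}))" .
  qed
  have "inj_on \<sigma> B"
  proof (rule inj_onI, rule ccontr)
    fix i j assume ij: "i \<in> B" "j \<in> B" "\<sigma> i = \<sigma> j" "i \<noteq> j"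
    then have "h ` {A \<in> ksubsets k B. i \<in> A} = h ` {A \<in> ksubsets k B. j \<in> A}"
      using stars[OF ij(1)] stars[OF ij(2)] by (simp only:)
    moreover have "{A \<in> ksubsets k B. l \<in> A} \<subseteq> ksubsets k B" for l by blast
    ultimately have "{A \<in> ksubsets k B. i \<in> A} = {A \<in> ksubsets k B. j \<in> A}"
      using inj_on_image_eq_iff[OF inj] by metis
    moreover obtain A where "A \<in> ksubsets k B" "{i} \<subseteq> A" "A \<inter> {j} = {}"
      using ex_ksubset[OF fin(1), of "{i}" "{j}" k] ij k card by auto
    ultimately show False by blast
  qed
  moreover have "\<sigma> ` B = B'"
  proof (rule card_subset_eq)
    show "card (\<sigma> ` B) = card B'" using calculation card by (simp add: card_image)
  qed (use fin sig_in in auto)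
  ultimately have bij: "bij_betw \<sigma> B B'" by (simp add: bij_betw_def)
  moreover have "h A = B' - \<sigma> ` A" if A: "A \<in> ksubsets k B" for A
  proof (rule card_subset_eq)
    show "finite (B' - \<sigma> ` A)" using fin by simp
    show "h A \<subseteq> B' - \<sigma> ` A" using img[OF A] avoid[OF A] by (auto simp: ksubsets_def)
    have AB: "A \<subseteq> B" "card A = k" using A by (auto simp: ksubsets_def)
    have "card (\<sigma> ` A) = k"
      using AB inj_on_subset[OF \<open>inj_on \<sigma> B\<close> AB(1)] by (simp add: card_image)
    moreover have "\<sigma> ` A \<subseteq> B'" using AB sig_in by auto
    ultimately have "card (B' - \<sigma> ` A) = n - k" using fin card
      by (simp add: card_Diff_subset finite_subset)
    then show "card (h A) = card (B' - \<sigma> ` A)" using img[OF A] by (auto simp: ksubsets_def)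
  qed
  ultimately show ?thesis by (rule that)
qed

section \<open>Coordinate subspaces\<close>

context finite_dimensional_vector_space
begin

definition is_basis :: "'b set \<Rightarrow> bool" where
  "is_basis B \<longleftrightarrow> independent B \<and> span B = UNIV"

definition coordinate_subspaces :: "nat \<Rightarrow> 'b set \<Rightarrow> 'b set set" where
  "coordinate_subspaces m B = span ` ksubsets m B"

lemma is_basis_independent: "is_basis B \<Longrightarrow> independent B"
  and is_basis_span: "is_basis B \<Longrightarrow> span B = UNIV"
  by (simp_all add: is_basis_def)

lemma is_basis_finite: "is_basis B \<Longrightarrow> finite B"
  by (simp add: is_basis_def finiteI_independent)

lemma is_basis_card: "is_basis B \<Longrightarrow> card B = dimension"
  using dim_eq_card_independent[of B] dim_span[of B] by (simp add: is_basis_def dimension_def)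

lemma spanning_is_basis:
  assumes "span B = UNIV" "finite B" "card B \<le> dimension"
  shows "is_basis B"
  using assms card_le_dim_spanning[of B UNIV] by (simp add: is_basis_def dimension_def)

lemma extend_to_basis:
  assumes "independent A"
  obtains B where "is_basis B" "A \<subseteq> B"
  using that independent_extend_basis[OF assms] span_extend_basis[OF assms]
    extend_basis_superset[OF assms] by (auto simp: is_basis_def)

lemma independent_full_is_basis:
  assumes "independent B" "card B = dimension"
  shows "is_basis B"
proof -
  obtain C where C: "is_basis C" "B \<subseteq> C" using extend_to_basis assms(1) by blast
  then have "B = C" using assms(2) is_basis_card is_basis_finite by (intro card_subset_eq) auto
  then show ?thesis using C by simp
qed

lemma representation_basis_add:
  "is_basis B \<Longrightarrow> representation B (x + y) b = representation B x b + representation B y b"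
  by (simp add: representation_add is_basis_def)

lemma representation_basis_scale:
  "is_basis B \<Longrightarrow> representation B (a *s x) b = a * representation B x b"
  by (simp add: representation_scale is_basis_def)

lemma representation_basis_base:
  "is_basis B \<Longrightarrow> b \<in> B \<Longrightarrow> representation B b c = (if c = b then 1 else 0)"
  by (simp add: representation_basis is_basis_def)

lemma representation_basis_zero [simp]: "representation B 0 b = 0"
  by (rule fun_cong[OF representation_zero, THEN trans]) simp

lemma in_span_subset_iff:
  assumes "is_basis B" "A \<subseteq> B"
  shows "v \<in> span A \<longleftrightarrow> (\<forall>b\<in>B - A. representation B v b = 0)"
proof
  assume v: "v \<in> span A"
  have "representation B v = representation A v"
    using representation_extend[OF is_basis_independent[OF assms(1)] v assms(2)] .
  then show "\<forall>b\<in>B - A. representation B v b = 0"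
    using representation_ne_zero[of A v] by auto
next
  assume z: "\<forall>b\<in>B - A. representation B v b = 0"
  have "v = (\<Sum>b\<in>B. representation B v b *s b)"
    using assms by (intro sum_representation_eq[symmetric]) (auto simp: is_basis_def is_basis_finite)
  also have "\<dots> = (\<Sum>b\<in>A. representation B v b *s b)"
    using z assms by (intro sum.mono_neutral_right) (auto simp: is_basis_finite)
  also have "\<dots> \<in> span A" by (intro span_sum span_scale span_base)
  finally show "v \<in> span A" .
qed

lemma span_subset_iff:
  assumes "is_basis B" "A \<subseteq> B" "A' \<subseteq> B"
  shows "span A \<subseteq> span A' \<longleftrightarrow> A \<subseteq> A'"
proof
  assume s: "span A \<subseteq> span A'"
  show "A \<subseteq> A'"
  proof
    fix b assume b: "b \<in> A"
    then have "b \<in> span A'" using s span_base by blast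
    moreover have "b \<in> B" using b assms(2) by blast
    ultimately show "b \<in> A'" using in_span_subset_iff[OF assms(1,3), of b]
      representation_basis_base[OF assms(1), of b b] by (metis DiffI zero_neq_one)
  qed
qed (rule span_mono)

lemma span_eq_iff:
  assumes "is_basis B" "A \<subseteq> B" "A' \<subseteq> B"
  shows "span A = span A' \<longleftrightarrow> A = A'"
  using span_subset_iff[OF assms] span_subset_iff[OF assms(1,3,2)] by blast

lemma inj_on_span: "is_basis B \<Longrightarrow> inj_on span (ksubsets m B)"
  by (rule inj_onI) (auto simp: ksubsets_def span_eq_iff)

lemma dim_span_subset: "is_basis B \<Longrightarrow> A \<subseteq> B \<Longrightarrow> dim (span A) = card A"
  using independent_mono[of B A] by (simp add: is_basis_def dim_eq_card_independent)

lemma coordinate_subspaces_subset: "is_basis B \<Longrightarrow> coordinate_subspaces m B \<subseteq> grassmannian m"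
  by (auto simp: coordinate_subspaces_def ksubsets_def grassmannian_def dim_span_subset simp del: dim_span)

lemma card_coordinate_subspaces:
  "is_basis B \<Longrightarrow> card (coordinate_subspaces m B) = dimension choose m"
  by (simp add: coordinate_subspaces_def card_image inj_on_span card_ksubsets is_basis_finite is_basis_card)

lemma finite_coordinate_subspaces: "is_basis B \<Longrightarrow> finite (coordinate_subspaces m B)"
  by (simp add: coordinate_subspaces_def finite_ksubsets is_basis_finite)

text \<open>Inside an m-dimensional subspace, m basis vectors span everything. So the families
  \<open>coordinate_subspaces m B\<close> are the maximal R-sets, and it is enough to follow these
  under \<open>f\<close>.\<close>

lemma R_set_iff: "R_set m R \<longleftrightarrow> (\<exists>B. is_basis B \<and> R \<subseteq> coordinate_subspaces m B)"
proof
  assume "R_set m R"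
  then obtain B where R: "R \<subseteq> grassmannian m" and B: "is_basis B"
    and S: "\<forall>U\<in>R. \<exists>S. S \<subseteq> B \<and> finite S \<and> card S = m \<and> S \<subseteq> U"
    by (auto simp: R_set_def is_basis_def)
  have "U \<in> coordinate_subspaces m B" if U: "U \<in> R" for U
  proof -
    obtain S where S: "S \<subseteq> B" "card S = m" "S \<subseteq> U" using S U by blast
    have sub: "subspace U" "dim U = m" using R U by (auto simp: grassmannian_def)
    have "span S = U"
    proof (rule subspace_dim_equal)
      show "span S \<subseteq> U" using S sub by (simp add: span_minimal)
      show "dim U \<le> dim (span S)" using dim_span_subset[OF B S(1)] S sub by simp
    qed (use sub in auto)
    then show ?thesis using S by (auto simp: coordinate_subspaces_def ksubsets_def)
  qed
  then show "\<exists>B. is_basis B \<and> R \<subseteq> coordinate_subspaces m B" using B by blast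
next
  assume "\<exists>B. is_basis B \<and> R \<subseteq> coordinate_subspaces m B"
  then obtain B where B: "is_basis B" "R \<subseteq> coordinate_subspaces m B" by blast
  have "\<exists>S. S \<subseteq> B \<and> finite S \<and> card S = m \<and> S \<subseteq> U" if U: "U \<in> R" for U
  proof -
    obtain S where S: "S \<subseteq> B" "card S = m" "U = span S"
      using U B(2) by (auto simp: coordinate_subspaces_def ksubsets_def)
    then have "finite S" using is_basis_finite[OF B(1)] finite_subset by blast
    then show ?thesis using S span_superset by blast
  qed
  moreover have "R \<subseteq> grassmannian m" using B coordinate_subspaces_subset by blast
  ultimately show "R_set m R" using B(1) unfolding R_set_def is_basis_def by blast
qed

section \<open>Regular bijections acting on families of coordinate subspaces\<close>

lemma regular_bijection_inv:
  assumes "regular_bijection k l f"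
  shows "regular_bijection l k (inv_into (grassmannian k) f)"
  unfolding regular_bijection_def
proof (intro conjI allI impI)
  have f: "bij_betw f (grassmannian k) (grassmannian l)"
    using assms by (simp add: regular_bijection_def)
  then show "bij_betw (inv_into (grassmannian k) f) (grassmannian l) (grassmannian k)"
    by (rule bij_betw_inv_into)
  show "R_set k (inv_into (grassmannian k) f ` R)" if "R_set l R" for R
    using assms that by (simp add: regular_bijection_def)
  show "R_set l (inv_into (grassmannian l) (inv_into (grassmannian k) f) ` R)" if R: "R_set k R" for R
  proof -
    have "inv_into (grassmannian l) (inv_into (grassmannian k) f) U = f U" if "U \<in> R" for U
      using inv_into_inv_into_eq[OF f, of U] R that by (auto simp: R_set_def)
    then have "inv_into (grassmannian l) (inv_into (grassmannian k) f) ` R = f ` R" by force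
    then show ?thesis using assms R by (simp add: regular_bijection_def)
  qed
qed

text \<open>Regularity gives only an inclusion, but both families have
  \<open>dimension choose k\<close> members by symmetry of the binomial coefficients.\<close>

lemma regular_bijection_frame:
  assumes f: "regular_bijection k (dimension - k) f" "k \<le> dimension" and B: "is_basis B"
  obtains B' where "is_basis B'"
    "f ` coordinate_subspaces k B = coordinate_subspaces (dimension - k) B'"
proof -
  have "R_set k (coordinate_subspaces k B)" using B by (auto simp: R_set_iff)
  then have "R_set (dimension - k) (f ` coordinate_subspaces k B)"
    using f by (simp add: regular_bijection_def)
  then obtain B' where B': "is_basis B'"
    "f ` coordinate_subspaces k B \<subseteq> coordinate_subspaces (dimension - k) B'"
    by (auto simp: R_set_iff)
  have "inj_on f (grassmannian k)" using f by (simp add: regular_bijection_def bij_betw_def)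
  then have "inj_on f (coordinate_subspaces k B)"
    using coordinate_subspaces_subset[OF B] inj_on_subset by blast
  then have "card (f ` coordinate_subspaces k B) = dimension choose k"
    by (simp add: card_image card_coordinate_subspaces B)
  also have "\<dots> = card (coordinate_subspaces (dimension - k) B')"
    using f(2) B' by (simp add: card_coordinate_subspaces binomial_symmetric[symmetric])
  finally have "f ` coordinate_subspaces k B = coordinate_subspaces (dimension - k) B'"
    using B' finite_coordinate_subspaces by (intro card_subset_eq) auto
  then show ?thesis using that B' by blast
qed

text \<open>Regularity of the inverse lets the basis be prescribed on the target side.\<close>

lemma regular_bijection_coframe:
  assumes f: "regular_bijection k (dimension - k) f" "k \<le> dimension" and B': "is_basis B'"
  obtains B where "is_basis B"
    "f ` coordinate_subspaces k B = coordinate_subspaces (dimension - k) B'"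
proof -
  let ?g = "inv_into (grassmannian k) f"
  have "regular_bijection (dimension - k) (dimension - (dimension - k)) ?g"
    using regular_bijection_inv[OF f(1)] f(2) by simp
  then obtain B where B: "is_basis B"
    "?g ` coordinate_subspaces (dimension - k) B' = coordinate_subspaces k B"
    using regular_bijection_frame B' f(2) by (metis diff_diff_cancel diff_le_self)
  have surj: "f ` grassmannian k = grassmannian (dimension - k)"
    using f by (simp add: regular_bijection_def bij_betw_def)
  have "f (?g W) = W" if "W \<in> coordinate_subspaces (dimension - k) B'" for W
    by (rule f_inv_into_f) (use that coordinate_subspaces_subset[OF B'] surj in blast)
  then have "f ` ?g ` coordinate_subspaces (dimension - k) B' = coordinate_subspaces (dimension - k) B'"
    by (force simp: image_image)
  then show ?thesis using that B by simp
qed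

text \<open>The basis \<open>B\<close> with \<open>i\<close> replaced by \<open>i + j\<close> has the same coordinate subspaces except
  for those that separate \<open>i\<close> from \<open>j\<close>.\<close>

lemma inexact_of_not_separating:
  assumes B: "is_basis B" and ij: "i \<in> B" "j \<in> B" "i \<noteq> j" and m: "1 \<le> m" "m < dimension"
  obtains B1 where "is_basis B1"
    "\<And>A. A \<in> ksubsets m B \<Longrightarrow> A \<notin> separating m B i j \<Longrightarrow> span A \<in> coordinate_subspaces m B1"
    "coordinate_subspaces m B1 \<noteq> coordinate_subspaces m B"
proof -
  define B1 where "B1 = insert (i + j) (B - {i})"
  have "i \<in> span B1"
  proof -
    have "(i + j) - j \<in> span B1"
      by (rule span_diff) (use ij in \<open>auto simp: B1_def intro!: span_base\<close>)
    then show ?thesis by simp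
  qed
  moreover have "B - {i} \<subseteq> span B1" using span_superset[of B1] by (auto simp: B1_def)
  ultimately have "B \<subseteq> span B1" by blast
  then have "span B \<subseteq> span B1" by (simp add: span_minimal)
  then have "span B1 = UNIV" using is_basis_span[OF B] by blast
  moreover have "card B1 \<le> dimension"
  proof -
    have "card B1 \<le> Suc (card (B - {i}))" by (simp add: B1_def card_insert_if is_basis_finite[OF B])
    also have "\<dots> = card B" by (rule card_Suc_Diff1[OF is_basis_finite[OF B] ij(1)])
    finally show ?thesis using is_basis_card[OF B] by simp
  qed
  ultimately have B1: "is_basis B1" by (intro spanning_is_basis) (auto simp: B1_def is_basis_finite[OF B])
  have new: "i + j \<notin> B - {i}"
  proof
    assume "i + j \<in> B - {i}"
    then have "B1 = B - {i}" unfolding B1_def by (rule insert_absorb)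
    then have "card B1 < card B" using card_Diff1_less[OF is_basis_finite[OF B] ij(1)] by simp
    then show False using B B1 by (simp add: is_basis_card)
  qed
  have shift: "insert (i + j) (A - {i}) \<in> ksubsets m B1"
    if A: "A \<in> ksubsets m B" "i \<in> A" for A
  proof -
    have sub: "A \<subseteq> B" "card A = m" using A by (simp_all add: ksubsets_def)
    then have fin: "finite A" using is_basis_finite[OF B] finite_subset by blast
    have "i + j \<notin> A - {i}" using new sub by blast
    then have "card (insert (i + j) (A - {i})) = Suc (card (A - {i}))" using fin by (meson card_insert_disjoint finite_Diff)
    also have "\<dots> = card A" by (rule card_Suc_Diff1[OF fin A(2)])
    finally have "card (insert (i + j) (A - {i})) = m" using sub by simp
    moreover have "insert (i + j) (A - {i}) \<subseteq> B1" unfolding B1_def using sub by blast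
    ultimately show ?thesis unfolding ksubsets_def by blast
  qed
  show ?thesis
  proof (rule that[OF B1])
    fix A assume A: "A \<in> ksubsets m B" "A \<notin> separating m B i j"
    show "span A \<in> coordinate_subspaces m B1"
    proof (cases "i \<in> A")
      case False
      then have "A \<in> ksubsets m B1" using A by (auto simp: ksubsets_def B1_def)
      then show ?thesis by (auto simp: coordinate_subspaces_def)
    next
      case True
      then have j: "j \<in> A" using A by (auto simp: separating_def)
      let ?A = "insert (i + j) (A - {i})"
      have "(i + j) - j \<in> span ?A" by (rule span_diff) (use j ij in \<open>auto intro!: span_base\<close>)
      then have "A \<subseteq> span ?A" using span_base[of _ ?A] by auto
      moreover have "?A \<subseteq> span A" using span_add[OF span_base[OF True] span_base[OF j]] span_base by blast
      ultimately have "span A = span ?A" by (simp add: span_eq)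
      then show ?thesis using shift[OF A(1) True] by (auto simp: coordinate_subspaces_def)
    qed
  next
    obtain A where A: "A \<in> ksubsets m B" "{i} \<subseteq> A" "A \<inter> {j} = {}"
      using ex_ksubset[OF is_basis_finite[OF B], of "{i}" "{j}" m] ij m is_basis_card[OF B] by auto
    let ?A = "insert (i + j) (A - {i})"
    have "span ?A \<in> coordinate_subspaces m B1" using shift[OF A(1)] A by (auto simp: coordinate_subspaces_def)
    \<comment> \<open>A coordinate subspace of \<open>B\<close> containing \<open>i + j\<close> also
      contains \<open>i\<close>. But every vector of \<open>span ?A\<close> has equal coordinates at
      \<open>i\<close> and \<open>j\<close>, because \<open>A\<close> contains \<open>i\<close> and
      not \<open>j\<close>.\<close>
    moreover have "span ?A \<notin> coordinate_subspaces m B"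
    proof
      assume "span ?A \<in> coordinate_subspaces m B"
      then obtain A' where A': "A' \<subseteq> B" "span ?A = span A'" by (auto simp: coordinate_subspaces_def ksubsets_def)
      have "i + j \<in> span A'" using A'(2) span_base[of "i + j" ?A] by simp
      moreover have "representation B (i + j) i = 1"
        using ij by (simp add: representation_basis_add[OF B] representation_basis_base[OF B])
      ultimately have "i \<in> A'" using in_span_subset_iff[OF B A'(1)] ij by force
      then have iA: "i \<in> span ?A" using A'(2) span_base by blast
      have "subspace {v. representation B v i = representation B v j}"
        by (auto simp: subspace_def representation_basis_add[OF B] representation_basis_scale[OF B])
      moreover have "?A \<subseteq> {v. representation B v i = representation B v j}"
        using A ij by (auto simp: representation_basis_add[OF B] representation_basis_base[OF B] ksubsets_def subset_iff)
      ultimately have "span ?A \<subseteq> {v. representation B v i = representation B v j}" by (rule span_minimal[rotated])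
      then have "representation B i i = representation B i j" using iA by blast
      then show False using ij by (simp add: representation_basis_base[OF B])
    qed
    ultimately show "coordinate_subspaces m B1 \<noteq> coordinate_subspaces m B" by blast
  qed
qed

lemma coordinate_subspaces_mono:
  assumes B: "is_basis B" "is_basis B1"
    and \<tau>: "\<And>i. i \<in> B \<Longrightarrow> \<tau> i \<in> B1 \<and> span {\<tau> i} = span {i}"
  shows "coordinate_subspaces m B \<subseteq> coordinate_subspaces m B1"
proof
  fix U assume "U \<in> coordinate_subspaces m B"
  then obtain A where A: "A \<subseteq> B" "card A = m" "U = span A" by (auto simp: coordinate_subspaces_def ksubsets_def)
  have "inj_on \<tau> A"
  proof (rule inj_onI)
    fix i j assume ij: "i \<in> A" "j \<in> A" "\<tau> i = \<tau> j"
    then have "span {i} = span {j}" using \<tau>[of i] \<tau>[of j] A by auto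
    then show "i = j" using span_eq_iff[OF B(1), of "{i}" "{j}"] ij A by auto
  qed
  then have "\<tau> ` A \<in> ksubsets m B1" using A \<tau> by (auto simp: ksubsets_def card_image)
  moreover have "span (\<tau> ` A) = span A"
  proof -
    have "\<tau> i \<in> span A" if "i \<in> A" for i
    proof -
      have "\<tau> i \<in> span {i}" using \<tau>[of i] A that span_base[of "\<tau> i" "{\<tau> i}"] by auto
      then show ?thesis using span_mono[of "{i}" A] that by auto
    qed
    moreover have "i \<in> span (\<tau> ` A)" if "i \<in> A" for i
    proof -
      have "i \<in> span {\<tau> i}" using \<tau>[of i] A that span_base[of i "{i}"] by auto
      then show ?thesis using span_mono[of "{\<tau> i}" "\<tau> ` A"] that by auto
    qed
    ultimately show ?thesis by (auto simp: span_eq)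
  qed
  ultimately show "U \<in> coordinate_subspaces m B1" using A by (auto simp: coordinate_subspaces_def)
qed

text \<open>Suppose every separating family has a member whose span is also a coordinate subspace of
  \<open>B1\<close>. Take \<open>c\<close> in \<open>B1\<close> occurring in the expansion of
  \<open>i\<close>. A common subspace containing \<open>i\<close> must contain \<open>c\<close>, so
  if it separates \<open>i\<close> from \<open>j\<close>, the \<open>j\<close>-coordinate of
  \<open>c\<close> vanishes. Letting \<open>j\<close> vary, \<open>c\<close> is proportional to
  \<open>i\<close>. Thus the two bases agree up to scalars and have the same coordinate
  subspaces.\<close>

lemma not_separating_of_inexact:
  assumes B: "is_basis B" "is_basis B1" and n: "2 \<le> dimension"
    and ne: "coordinate_subspaces m B \<noteq> coordinate_subspaces m B1"
  obtains i j where "i \<in> B" "j \<in> B" "i \<noteq> j"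
    "\<And>A. A \<in> separating m B i j \<Longrightarrow> span A \<notin> coordinate_subspaces m B1"
proof (rule ccontr)
  assume not: "\<not> thesis"
  note witness = that
  have ex: "\<exists>A\<in>separating m B i j. span A \<in> coordinate_subspaces m B1"
    if "i \<in> B" "j \<in> B" "i \<noteq> j" for i j using witness[OF that] not by blast
  have "\<exists>c. c \<in> B1 \<and> span {c} = span {i}" if i: "i \<in> B" for i
  proof -
    have i0: "i \<noteq> 0" using i B is_basis_independent dependent_zero by blast
    have "\<exists>c\<in>B1. representation B1 i c \<noteq> 0"
    proof (rule ccontr)
      assume "\<not> (\<exists>c\<in>B1. representation B1 i c \<noteq> 0)"
      then have "i \<in> span {}" using in_span_subset_iff[OF B(2), of "{}" i] by auto
      then show False using i0 by simp
    qed
    then obtain c where c: "c \<in> B1" "representation B1 i c \<noteq> 0" by blast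
    have "representation B c j = 0" if j: "j \<in> B - {i}" for j
    proof -
      obtain A where A: "A \<in> separating m B i j" "span A \<in> coordinate_subspaces m B1"
        using ex[of i j] i j by blast
      then obtain A1 where A1: "A1 \<subseteq> B1" "span A = span A1" by (auto simp: coordinate_subspaces_def ksubsets_def)
      have "i \<in> span A1" using A A1 span_base by (auto simp: separating_def)
      then have "c \<in> A1" using in_span_subset_iff[OF B(2) A1(1), of i] c by blast
      then have "c \<in> span A" using A1 span_base by blast
      moreover have "A \<subseteq> B" "j \<notin> A" using A by (auto simp: separating_def ksubsets_def)
      ultimately show ?thesis using in_span_subset_iff[OF B(1), of A c] j by auto
    qed
    then have ci: "c \<in> span {i}" using in_span_subset_iff[OF B(1), of "{i}" c] i by auto
    then obtain a where a: "c = a *s i" by (auto simp: span_singleton)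
    have "c \<noteq> 0" using c B is_basis_independent dependent_zero by blast
    then have "i = inverse a *s c" using a by auto
    then have "i \<in> span {c}" by (metis span_base span_scale singletonI)
    then show ?thesis using ci c by (intro exI[of _ c]) (auto simp: span_eq)
  qed
  then obtain \<tau> where "\<And>i. i \<in> B \<Longrightarrow> \<tau> i \<in> B1 \<and> span {\<tau> i} = span {i}" by metis
  from coordinate_subspaces_mono[OF B this]
  have "coordinate_subspaces m B \<subseteq> coordinate_subspaces m B1" .
  then have "coordinate_subspaces m B = coordinate_subspaces m B1"
    using B by (intro card_subset_eq) (auto simp: finite_coordinate_subspaces card_coordinate_subspaces)
  then show False using ne by simp
qed

theorem regular_bijection_frame_permutation:
  assumes f: "regular_bijection k (dimension - k) f" and k: "1 \<le> k" "2 * k < dimension"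
    and B: "is_basis B" "is_basis B'"
    and fB: "f ` coordinate_subspaces k B = coordinate_subspaces (dimension - k) B'"
  obtains \<sigma> where "bij_betw \<sigma> B B'"
    "\<And>A. A \<in> ksubsets k B \<Longrightarrow> f (span A) = span (B' - \<sigma> ` A)"
proof -
  let ?l = "dimension - k"
  have n: "2 \<le> dimension" using k by linarith
  define h where "h A = inv_into (ksubsets ?l B') span (f (span A))" for A
  have inj: "inj_on f (grassmannian k)" using f by (simp add: regular_bijection_def bij_betw_def)
  have "bij_betw span (ksubsets k B) (coordinate_subspaces k B)"
    using inj_on_span[OF B(1)] by (simp add: bij_betw_def coordinate_subspaces_def)
  moreover have "bij_betw f (coordinate_subspaces k B) (coordinate_subspaces ?l B')"
    using inj_on_subset[OF inj coordinate_subspaces_subset[OF B(1)]] fB by (simp add: bij_betw_def)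
  moreover have "bij_betw (inv_into (ksubsets ?l B') span) (coordinate_subspaces ?l B') (ksubsets ?l B')"
    by (rule bij_betw_inv_into) (use inj_on_span[OF B(2)] in \<open>simp add: bij_betw_def coordinate_subspaces_def\<close>)
  ultimately have "bij_betw (inv_into (ksubsets ?l B') span \<circ> (f \<circ> span)) (ksubsets k B) (ksubsets ?l B')"
    by (blast intro: bij_betw_trans)
  then have h: "bij_betw h (ksubsets k B) (ksubsets ?l B')"
    by (rule bij_betw_cong[THEN iffD1, rotated]) (simp add: h_def)
  have span_h: "span (h A) = f (span A)" if "A \<in> ksubsets k B" for A
  proof -
    have "f (span A) \<in> span ` ksubsets ?l B'"
      using fB that unfolding coordinate_subspaces_def by blast
    then show ?thesis unfolding h_def by (rule f_inv_into_f)
  qed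
  have sep: "\<exists>i'\<in>B'. \<exists>j'\<in>B'. i' \<noteq> j' \<and> separating ?l B' i' j' \<subseteq> h ` separating k B i j"
    if ij: "i \<in> B" "j \<in> B" "i \<noteq> j" for i j
  proof -
    \<comment> \<open>\<open>B1\<close> retains every coordinate subspace of \<open>B\<close> that
      does not separate \<open>i\<close> from \<open>j\<close>, yet its family differs from that of
      \<open>B\<close>. So the image family, belonging to \<open>B1'\<close>, differs from that of
      \<open>B'\<close> and misses a whole separating family of \<open>B'\<close>; the members of
      the latter can come only from \<open>separating k B i j\<close>.\<close>
    obtain B1 where B1: "is_basis B1"
      "\<And>A. A \<in> ksubsets k B \<Longrightarrow> A \<notin> separating k B i j \<Longrightarrow> span A \<in> coordinate_subspaces k B1"
      "coordinate_subspaces k B1 \<noteq> coordinate_subspaces k B"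
      using inexact_of_not_separating[OF B(1) ij, of k] k by auto
    obtain B1' where B1': "is_basis B1'" "f ` coordinate_subspaces k B1 = coordinate_subspaces ?l B1'"
      using regular_bijection_frame[OF f _ B1(1)] k by auto
    have "coordinate_subspaces ?l B' \<noteq> coordinate_subspaces ?l B1'"
      using B1(3) fB B1'(2) inj_on_image_eq_iff[OF inj] coordinate_subspaces_subset B(1) B1(1) by metis
    then obtain i' j' where ij': "i' \<in> B'" "j' \<in> B'" "i' \<noteq> j'"
      "\<And>A. A \<in> separating ?l B' i' j' \<Longrightarrow> span A \<notin> coordinate_subspaces ?l B1'"
      using not_separating_of_inexact[OF B(2) B1'(1) n] by blast
    have "separating ?l B' i' j' \<subseteq> h ` separating k B i j"
    proof
      fix A' assume A': "A' \<in> separating ?l B' i' j'"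
      then obtain A where A: "A \<in> ksubsets k B" "A' = h A" using h by (auto simp: bij_betw_def separating_def)
      have "A \<in> separating k B i j"
      proof (rule ccontr)
        assume "A \<notin> separating k B i j"
        then have "f (span A) \<in> coordinate_subspaces ?l B1'" using B1(2)[OF A(1)] B1'(2) by blast
        then show False using ij'(4)[OF A'] A span_h by simp
      qed
      then show "A' \<in> h ` separating k B i j" using A by blast
    qed
    then show ?thesis using ij' by blast
  qed
  obtain \<sigma> where s: "bij_betw \<sigma> B B'" "\<And>A. A \<in> ksubsets k B \<Longrightarrow> h A = B' - \<sigma> ` A"
    using ksubsets_bijection_complement[OF is_basis_finite[OF B(1)] is_basis_finite[OF B(2)]
      is_basis_card[OF B(1)] is_basis_card[OF B(2)] k h sep] by blast
  show ?thesis by (rule that[OF s(1)]) (simp add: span_h[symmetric] s(2))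
qed

end

section \<open>The hyperplane of a point\<close>

lemma field_automorphismD:
  assumes "field_automorphism \<phi>"
  shows "\<phi> (a + b) = \<phi> a + \<phi> b" "\<phi> (a * b) = \<phi> a * \<phi> b" "\<phi> 1 = 1" "bij \<phi>"
  using assms by (simp_all add: field_automorphism_def)

lemma field_automorphism_inverse:
  assumes phi: "field_automorphism (\<phi> :: 'a::field \<Rightarrow> 'a)"
  obtains \<psi> where "field_automorphism \<psi>" "\<And>a. \<psi> (\<phi> a) = a" "\<And>a. \<psi> a = 0 \<longleftrightarrow> a = 0"
proof -
  define \<psi> where "\<psi> = inv \<phi>"
  note phi_hom = field_automorphismD[OF phi] and bij = field_automorphismD(4)[OF phi]
  have psi_phi: "\<psi> (\<phi> a) = a" for a unfolding \<psi>_def by (simp add: bij bij_is_inj)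
  have phi_psi: "\<phi> (\<psi> a) = a" for a unfolding \<psi>_def by (simp add: bij bij_is_surj surj_f_inv_f)
  have psi: "\<psi> (a + b) = \<psi> a + \<psi> b" "\<psi> (a * b) = \<psi> a * \<psi> b" "\<psi> 1 = 1" for a b
    using psi_phi[of "\<psi> a + \<psi> b"] psi_phi[of "\<psi> a * \<psi> b"] psi_phi[of 1]
    by (simp_all add: phi_hom phi_psi)
  have "\<phi> 0 + \<phi> 0 = \<phi> 0 + 0" using phi_hom(1)[of 0 0] by (simp only: add_0_right)
  then have phi0: "\<phi> 0 = 0" by (simp only: add_left_cancel)
  show ?thesis
  proof (rule that)
    show "field_automorphism \<psi>"
      unfolding field_automorphism_def using psi bij_imp_bij_inv[OF bij] by (auto simp: \<psi>_def)
    show "\<psi> (\<phi> a) = a" for a by (rule psi_phi)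
    show "\<psi> a = 0 \<longleftrightarrow> a = 0" for a using phi_psi[of a] psi_phi[of 0] phi0 by auto
  qed
qed

context vector_space
begin

lemma indep2_independent:
  assumes "indep2 x y" shows "x \<noteq> y" "independent {x, y}"
proof -
  show "x \<noteq> y" using assms by (metis indep2_iff scale_one)
  have "y \<notin> span {x}" using assms by (auto simp: indep2_iff span_singleton)
  moreover have "independent {x}" using assms by (simp add: indep2_iff)
  ultimately show "independent {x, y}" using independent_insertI by (metis insert_commute)
qed

lemma indep3_independent:
  assumes "indep3 x y z"
  shows "x \<noteq> y" "x \<noteq> z" "y \<noteq> z" "independent {x, y, z}"
proof -
  have yz: "indep2 y z" using assms by (rule indep3_indep2)
  show "y \<noteq> z" using indep2_independent(1)[OF yz] .
  show "x \<noteq> y" using indep3D[OF assms, of 1 "-1" 0] by auto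
  show "x \<noteq> z" using indep3D[OF assms, of 1 0 "-1"] by auto
  have "x \<notin> span {y, z}"
  proof
    assume "x \<in> span {y, z}"
    then obtain a b where "x - a *s y = b *s z" by (auto simp: span_insert span_singleton)
    then have "1 *s x + (- a) *s y + (- b) *s z = 0" by simp
    from indep3D(1)[OF assms this] show False by simp
  qed
  then show "independent {x, y, z}" using indep2_independent(2)[OF yz] by (rule independent_insertI)
qed

definition linear_form :: "('b \<Rightarrow> 'a) \<Rightarrow> bool" where
  "linear_form g \<longleftrightarrow> (\<forall>x y. g (x + y) = g x + g y) \<and> (\<forall>a x. g (a *s x) = a * g x)"

lemma linear_form_diff: "linear_form g \<Longrightarrow> g (x - y) = g x - g y"
proof -
  assume "linear_form g"
  then have "g (x - y + y) = g (x - y) + g y" unfolding linear_form_def by blast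
  then show ?thesis by simp
qed

lemma linear_form_kernel_subset:
  assumes "linear_form g" "linear_form h" "\<And>v. g v = 0 \<Longrightarrow> h v = 0"
  shows "\<exists>c. \<forall>v. h v = c * g v"
proof (cases "\<exists>v. g v \<noteq> 0")
  case True
  then obtain w where w: "g w \<noteq> 0" by blast
  have "h v = (h w / g w) * g v" for v
  proof -
    have "g (v - (g v / g w) *s w) = 0" using assms(1) w
      by (simp add: linear_form_diff linear_form_def)
    then have "h (v - (g v / g w) *s w) = 0" by (rule assms(3))
    then show ?thesis using assms(2) w by (simp add: linear_form_diff linear_form_def field_simps)
  qed
  then show ?thesis by blast
qed (use assms(3) in auto)

text \<open>Subtracting a suitable multiple of \<open>g1\<close> from \<open>h\<close> makes the
  difference vanish on the kernel of \<open>g2\<close>, which reduces the claim to one form. It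
  turns an inclusion between intersections of hyperplanes into a linear relation, the shape required
  by \<open>line\<close>.\<close>

lemma linear_form_kernel_Int_subset:
  assumes l: "linear_form g1" "linear_form g2" "linear_form h"
    and k: "\<And>v. g1 v = 0 \<Longrightarrow> g2 v = 0 \<Longrightarrow> h v = 0"
  shows "\<exists>c d. \<forall>v. h v = c * g1 v + d * g2 v"
proof (cases "\<exists>w. g2 w = 0 \<and> g1 w \<noteq> 0")
  case True
  then obtain w where w: "g2 w = 0" "g1 w \<noteq> 0" by blast
  define c where "c = h w / g1 w"
  have "linear_form (\<lambda>v. h v - c * g1 v)" using l by (simp add: linear_form_def algebra_simps)
  moreover have "h v - c * g1 v = 0" if "g2 v = 0" for v
  proof -
    have "g1 (v - (g1 v / g1 w) *s w) = 0" "g2 (v - (g1 v / g1 w) *s w) = 0" using l w that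
      by (simp_all add: linear_form_diff) (simp_all add: linear_form_def)
    then have "h (v - (g1 v / g1 w) *s w) = 0" by (rule k)
    then show ?thesis using l(3) w by (simp add: linear_form_diff c_def) (simp add: linear_form_def field_simps)
  qed
  ultimately obtain d where "\<forall>v. h v - c * g1 v = d * g2 v"
    using linear_form_kernel_subset[OF l(2)] by blast
  then have "\<forall>v. h v = c * g1 v + d * g2 v" by (simp add: algebra_simps)
  then show ?thesis by blast
next
  case False
  then obtain d where "\<forall>v. h v = d * g2 v" using linear_form_kernel_subset[OF l(2,3)] k by blast
  then have "\<forall>v. h v = 0 * g1 v + d * g2 v" by simp
  then show ?thesis by blast
qed

end

text \<open>Hyperplanes will be represented by linear forms, and the space of all functions serves
  as target of the collineation so that no type of linear forms is required.\<close>

lemma vector_space_fun: "vector_space (\<lambda>(c::'a::field) (g::'b \<Rightarrow> 'a) v. c * g v)"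
  by (unfold_locales) (auto simp: fun_eq_iff algebra_simps)

context finite_dimensional_vector_space
begin

lemma basis_indep3:
  assumes B: "is_basis B" and xyz: "x \<in> B" "y \<in> B" "z \<in> B" "x \<noteq> y" "x \<noteq> z" "y \<noteq> z"
  shows "indep3 x y z"
  unfolding indep3_def
proof (intro allI impI)
  fix a b c assume s: "a *s x + b *s y + c *s z = 0"
  have r: "representation B (a *s x + b *s y + c *s z) u
      = (if u = x then a else 0) + (if u = y then b else 0) + (if u = z then c else 0)" for u
    using xyz by (simp add: representation_basis_add[OF B] representation_basis_scale[OF B] representation_basis_base[OF B])
  show "a = 0 \<and> b = 0 \<and> c = 0"
    using r[of x, unfolded s] r[of y, unfolded s] r[of z, unfolded s] xyz by simp
qed

lemma ex_indep2:
  assumes "3 \<le> dimension" "x \<noteq> 0"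
  shows "\<exists>y. indep2 x y"
proof -
  obtain B where B: "is_basis B" "{x} \<subseteq> B" using extend_to_basis[of "{x}"] assms by auto
  have "\<not> B \<subseteq> {x}" using is_basis_card[OF B(1)] assms card_mono[of "{x}" B] by auto
  then obtain y where y: "y \<in> B" "y \<noteq> x" by blast
  have "y \<notin> span {x}" using in_span_subset_iff[OF B, of y] y representation_basis_base[OF B(1) y(1), of y] by auto
  then have "indep2 x y" using assms(2) by (auto simp: indep2_iff span_singleton)
  then show ?thesis by blast
qed

lemma ex_indep3:
  assumes "3 \<le> dimension" "indep2 x y"
  shows "\<exists>z. indep3 x y z"
proof -
  obtain B where B: "is_basis B" "{x, y} \<subseteq> B" using extend_to_basis indep2_independent[OF assms(2)] by blast
  have "\<not> B \<subseteq> {x, y}"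
  proof
    assume "B \<subseteq> {x, y}"
    then have "card B \<le> card {x, y}" by (intro card_mono) auto
    also have "\<dots> \<le> 2" by (simp add: card_insert_if)
    finally show False using is_basis_card[OF B(1)] assms(1) by simp
  qed
  then obtain z where z: "z \<in> B" "z \<noteq> x" "z \<noteq> y" by blast
  then show ?thesis using basis_indep3[OF B(1), of x y z] B(2) indep2_independent(1)[OF assms(2)] by auto
qed

lemma grassmannian_basis:
  assumes U: "U \<in> grassmannian m" and S: "independent S" "S \<subseteq> U"
  obtains A B where "is_basis B" "A \<in> ksubsets m B" "S \<subseteq> A" "U = span A"
proof -
  have sub: "subspace U" "dim U = m" using U by (auto simp: grassmannian_def)
  obtain A where A: "S \<subseteq> A" "A \<subseteq> U" "independent A" "U \<subseteq> span A"
    using maximal_independent_subset_extend[OF S(2,1)] by blast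
  have "span A = U" using A sub span_minimal by blast
  moreover have "card A = m" using A sub basis_card_eq_dim by blast
  moreover obtain B where "is_basis B" "A \<subseteq> B" using extend_to_basis A(3) by blast
  ultimately show ?thesis using that A by (auto simp: ksubsets_def)
qed

lemma basis_nonzero: "is_basis B \<Longrightarrow> b \<in> B \<Longrightarrow> b \<noteq> 0"
  using dependent_zero is_basis_independent by blast

end

section \<open>Hyperplanes attached to points when 2k < n\<close>

locale regular_duality = finite_dimensional_vector_space scale Basis
  for scale :: "'a::field \<Rightarrow> 'b::ab_group_add \<Rightarrow> 'b" (infixr \<open>*s\<close> 75) and Basis +
  fixes k :: nat and f :: "'b set \<Rightarrow> 'b set"
  assumes regular: "regular_bijection k (dimension - k) f"
    and k: "1 \<le> k" "2 * k < dimension"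
begin

definition frame :: "'b set \<Rightarrow> 'b set \<Rightarrow> ('b \<Rightarrow> 'b) \<Rightarrow> bool" where
  "frame B B' \<sigma> \<longleftrightarrow> is_basis B \<and> is_basis B' \<and> bij_betw \<sigma> B B' \<and>
     (\<forall>A\<in>ksubsets k B. f (span A) = span (B' - \<sigma> ` A))"

text \<open>For nonzero \<open>x\<close> this is a hyperplane, the future orthogonal complement of
  \<open>x\<close>. No basis occurs in it, so independence of the choice of a basis has to be shown
  when it is computed.\<close>

definition polar :: "'b \<Rightarrow> 'b set" where
  "polar x = span (\<Union>U\<in>{U \<in> grassmannian k. x \<in> U}. f U)"

lemma dim3: "3 \<le> dimension" using k by linarith

lemma ex_frame:
  assumes "is_basis B" obtains B' \<sigma> where "frame B B' \<sigma>"
proof -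
  obtain B' where B': "is_basis B'" "f ` coordinate_subspaces k B = coordinate_subspaces (dimension - k) B'"
    using regular_bijection_frame[OF regular _ assms] k by auto
  obtain \<sigma> where "bij_betw \<sigma> B B'" "\<And>A. A \<in> ksubsets k B \<Longrightarrow> f (span A) = span (B' - \<sigma> ` A)"
    by (rule regular_bijection_frame_permutation[OF regular k assms B']) blast
  then have "frame B B' \<sigma>" using assms B' by (simp add: frame_def)
  then show ?thesis by (rule that)
qed

lemma ex_coframe:
  assumes "is_basis B'" obtains B \<sigma> where "frame B B' \<sigma>"
proof -
  obtain B where B: "is_basis B" "f ` coordinate_subspaces k B = coordinate_subspaces (dimension - k) B'"
    using regular_bijection_coframe[OF regular _ assms] k by auto
  obtain \<sigma> where "bij_betw \<sigma> B B'" "\<And>A. A \<in> ksubsets k B \<Longrightarrow> f (span A) = span (B' - \<sigma> ` A)"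
    by (rule regular_bijection_frame_permutation[OF regular k B(1) assms B(2)]) blast
  then have "frame B B' \<sigma>" using assms B by (simp add: frame_def)
  then show ?thesis by (rule that)
qed

lemma frameD:
  assumes "frame B B' \<sigma>"
  shows "is_basis B" "is_basis B'" "inj_on \<sigma> B" "\<sigma> ` B = B'"
    "A \<in> ksubsets k B \<Longrightarrow> f (span A) = span (B' - \<sigma> ` A)"
  using assms by (auto simp: frame_def bij_betw_def)

lemma frame_image: "frame B B' \<sigma> \<Longrightarrow> A \<subseteq> B \<Longrightarrow> \<sigma> ` A \<subseteq> B'"
  using image_mono[of A B \<sigma>] frameD(4) by metis

text \<open>Each basis vector \<open>\<sigma> d\<close> with \<open>d\<close> outside
  \<open>T\<close> lies in \<open>f (span A)\<close> for some k-subset \<open>A\<close> that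
  contains \<open>T\<close> and avoids both \<open>D\<close> and \<open>d\<close>. The strict
  inequality \<open>k + card D < dimension\<close> leaves room for the extra
  \<open>d\<close>.\<close>

lemma span_images_frame:
  assumes F: "frame B B' \<sigma>" and T: "T \<subseteq> B" "D \<subseteq> B - T" "card T \<le> k" "k + card D < dimension"
  shows "span (\<Union>A\<in>{A \<in> ksubsets k B. T \<subseteq> A \<and> A \<inter> D = {}}. f (span A)) = span (B' - \<sigma> ` T)"
    (is "span ?S = _")
proof
  note FD = frameD[OF F]
  have "?S \<subseteq> span (B' - \<sigma> ` T)"
  proof
    fix v assume "v \<in> ?S"
    then obtain A where A: "A \<in> ksubsets k B" "T \<subseteq> A" "v \<in> f (span A)" by blast
    then have "v \<in> span (B' - \<sigma> ` A)" using FD(5) by simp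
    moreover have "B' - \<sigma> ` A \<subseteq> B' - \<sigma> ` T" using A(2) by blast
    ultimately show "v \<in> span (B' - \<sigma> ` T)" using span_mono[of "B' - \<sigma> ` A" "B' - \<sigma> ` T"] by blast
  qed
  then show "span ?S \<subseteq> span (B' - \<sigma> ` T)" by (rule span_minimal[OF _ subspace_span])
  have "B' - \<sigma> ` T \<subseteq> span ?S"
  proof
    fix c assume "c \<in> B' - \<sigma> ` T"
    then obtain d where d: "d \<in> B" "d \<notin> T" "c = \<sigma> d" using FD(4) by blast
    have fin: "finite B" using is_basis_finite FD(1) .
    then have "finite D" using T(2) finite_subset by blast
    then have "card (insert d D) \<le> Suc (card D)" by (simp add: card_insert_if)
    then have "k + card (insert d D) \<le> card B" using T(4) is_basis_card[OF FD(1)] by simp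
    moreover have "insert d D \<subseteq> B - T" using d T(2) by blast
    ultimately obtain A where A: "A \<in> ksubsets k B" "T \<subseteq> A" "A \<inter> insert d D = {}"
      using ex_ksubset[OF fin T(1) _ T(3), of "insert d D"] by metis
    have "A \<subseteq> B" using A by (simp add: ksubsets_def)
    then have "\<sigma> d \<notin> \<sigma> ` A" using A(3) d(1) inj_on_image_mem_iff[OF FD(3)] by blast
    moreover have "\<sigma> d \<in> B'" using d(1) FD(4) by (metis imageI)
    ultimately have "c \<in> B' - \<sigma> ` A" using d(3) by simp
    then have "c \<in> f (span A)" unfolding FD(5)[OF A(1)] by (rule span_base)
    moreover have "A \<inter> D = {}" using A(3) by blast
    ultimately have "c \<in> ?S" using A(1,2) by blast
    then show "c \<in> span ?S" by (rule span_base)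
  qed
  then show "span (B' - \<sigma> ` T) \<subseteq> span ?S" by (rule span_minimal[OF _ subspace_span])
qed

definition star_span :: "'b set \<Rightarrow> 'b \<Rightarrow> 'b set" where
  "star_span B b = span (\<Union>A\<in>{A \<in> ksubsets k B. b \<in> A}. f (span A))"

lemma star_span_frame:
  assumes "frame B B' \<sigma>" "b \<in> B"
  shows "star_span B b = span (B' - {\<sigma> b})"
  using span_images_frame[OF assms(1), of "{b}" "{}"] assms(2) k by (simp add: star_span_def)

text \<open>Because \<open>k + 2 \<le> n\<close>, the subspaces avoiding one further basis vector already span
  the hyperplane, so replacing that vector changes nothing.\<close>

lemma star_span_remove:
  assumes B: "is_basis B" and b: "b \<in> B" "x \<in> B" "x \<noteq> b"
  shows "star_span B b = span (\<Union>A\<in>{A \<in> ksubsets k (B - {x}). b \<in> A}. f (span A))"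
proof -
  obtain B' \<sigma> where F: "frame B B' \<sigma>" using ex_frame B .
  have "{A \<in> ksubsets k B. {b} \<subseteq> A \<and> A \<inter> {x} = {}} = {A \<in> ksubsets k (B - {x}). b \<in> A}"
    by (auto simp: ksubsets_def)
  then show ?thesis
    using span_images_frame[OF F, of "{b}" "{x}"] star_span_frame[OF F b(1)] b k by simp
qed

text \<open>Steinitz exchange: a vector of \<open>B\<close> outside \<open>C\<close> is traded for
  one of \<open>C\<close>, keeping \<open>b\<close>. The old and the new basis agree after removal
  of the traded vectors, so by \<open>star_span_remove\<close> the span is unchanged, and
  \<open>B\<close> has come closer to \<open>C\<close>.\<close>

lemma star_span_unique:
  assumes "is_basis B" "is_basis C" "b \<in> B" "b \<in> C"
  shows "star_span B b = star_span C b"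
  using assms
proof (induction "card (B - C)" arbitrary: B rule: less_induct)
  case less
  have fin: "finite B" using is_basis_finite less.prems(1) .
  show ?case
  proof (cases "B \<subseteq> C")
    case True
    then have "B = C" using less.prems is_basis_card is_basis_finite by (intro card_subset_eq) auto
    then show ?thesis by simp
  next
    case False
    then obtain x where x: "x \<in> B" "x \<notin> C" by blast
    have "\<not> C \<subseteq> span (B - {x})"
    proof
      assume "C \<subseteq> span (B - {x})"
      then have "span C \<subseteq> span (B - {x})" by (simp add: span_minimal)
      then have "x \<in> span (B - {x})" using is_basis_span[OF less.prems(2)] by blast
      then show False using is_basis_independent[OF less.prems(1)] x(1) dependent_def by blast
    qed
    then obtain y where y: "y \<in> C" "y \<notin> span (B - {x})" by blast
    have yB: "y \<notin> B" using y x span_base[of y "B - {x}"] by blast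
    define D where "D = insert y (B - {x})"
    have "independent (B - {x})" using is_basis_independent[OF less.prems(1)] independent_mono by blast
    then have "independent D" unfolding D_def using y(2) independent_insertI by blast
    moreover have "card D = card B" unfolding D_def
      using card_Suc_Diff1[OF fin x(1)] yB fin by (simp add: card_insert_if)
    ultimately have D: "is_basis D" using independent_full_is_basis is_basis_card[OF less.prems(1)] by simp
    have bx: "b \<noteq> x" and by': "b \<noteq> y" using less.prems x yB by blast+
    have bD: "b \<in> D" using less.prems bx by (simp add: D_def)
    have "D - {y} = B - {x}" using yB by (auto simp: D_def)
    then have "star_span B b = star_span D b"
      using star_span_remove[OF less.prems(1,3) x(1)] star_span_remove[OF D bD, of y] bx by'
      by (simp add: D_def)
    moreover have "card (D - C) < card (B - C)"
    proof (rule psubset_card_mono)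
      show "D - C \<subset> B - C" using x y by (auto simp: D_def)
    qed (use fin in simp)
    ultimately show ?thesis using less.hyps[OF _ D less.prems(2) bD less.prems(4)] by simp
  qed
qed

text \<open>Every k-subspace through \<open>b\<close> is a coordinate subspace of some basis
  containing \<open>b\<close>, and all such bases give the same span.\<close>

lemma polar_eq_star_span:
  assumes B: "is_basis B" "b \<in> B"
  shows "polar b = star_span B b"
proof
  have "span A \<in> {U \<in> grassmannian k. b \<in> U}" if "A \<in> ksubsets k B" "b \<in> A" for A
    using coordinate_subspaces_subset[OF B(1), of k] that span_base by (auto simp: coordinate_subspaces_def)
  then have "(\<Union>A\<in>{A \<in> ksubsets k B. b \<in> A}. f (span A)) \<subseteq> (\<Union>U\<in>{U \<in> grassmannian k. b \<in> U}. f U)"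
    by blast
  then show "star_span B b \<subseteq> polar b" unfolding star_span_def polar_def by (rule span_mono)
  have "f U \<subseteq> star_span B b" if U: "U \<in> grassmannian k" "b \<in> U" for U
  proof -
    have "independent {b}" "{b} \<subseteq> U" using U(2) basis_nonzero[OF B] by simp_all
    then obtain A C where A: "is_basis C" "A \<in> ksubsets k C" "{b} \<subseteq> A" "U = span A"
      by (rule grassmannian_basis[OF U(1)])
    have bC: "b \<in> C" using A by (auto simp: ksubsets_def)
    have "f U \<subseteq> (\<Union>A\<in>{A \<in> ksubsets k C. b \<in> A}. f (span A))" using A by blast
    also have "\<dots> \<subseteq> star_span C b" unfolding star_span_def by (rule span_superset)
    also have "\<dots> = star_span B b" by (rule star_span_unique[OF A(1) B(1) bC B(2)])
    finally show ?thesis .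
  qed
  then have "(\<Union>U\<in>{U \<in> grassmannian k. b \<in> U}. f U) \<subseteq> star_span B b" by blast
  then show "polar b \<subseteq> star_span B b" unfolding polar_def
    by (rule span_minimal) (simp add: star_span_def)
qed

lemma polar_frame: "frame B B' \<sigma> \<Longrightarrow> b \<in> B \<Longrightarrow> polar b = span (B' - {\<sigma> b})"
  using polar_eq_star_span star_span_frame frameD(1) by metis

lemma f_subset_polar: "U \<in> grassmannian k \<Longrightarrow> x \<in> U \<Longrightarrow> f U \<subseteq> polar x"
  unfolding polar_def using span_superset by fastforce

lemma in_polar_frame_iff:
  assumes "frame B B' \<sigma>" "b \<in> B"
  shows "v \<in> polar b \<longleftrightarrow> representation B' v (\<sigma> b) = 0"
proof -
  have "\<sigma> b \<in> B'" using frameD(4)[OF assms(1)] assms(2) by blast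
  then have "B' - (B' - {\<sigma> b}) = {\<sigma> b}" by blast
  then show ?thesis
    using in_span_subset_iff[OF frameD(2)[OF assms(1)], of "B' - {\<sigma> b}" v] polar_frame[OF assms] by simp
qed

lemma f_span_eq:
  assumes B: "is_basis B" and A: "A \<in> ksubsets k B"
  shows "f (span A) = (\<Inter>a\<in>A. polar a)"
proof -
  obtain B' \<sigma> where F: "frame B B' \<sigma>" using ex_frame B .
  have AB: "A \<subseteq> B" using A by (simp add: ksubsets_def)
  have "\<sigma> ` A \<subseteq> B'" by (rule frame_image[OF F AB])
  then have "B' - (B' - \<sigma> ` A) = \<sigma> ` A" by (simp add: double_diff)
  then have "v \<in> f (span A) \<longleftrightarrow> (\<forall>a\<in>A. representation B' v (\<sigma> a) = 0)" for v
    using in_span_subset_iff[OF frameD(2)[OF F], of "B' - \<sigma> ` A" v] frameD(5)[OF F A] by simp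
  moreover have "v \<in> polar a \<longleftrightarrow> representation B' v (\<sigma> a) = 0" if "a \<in> A" for a v
    using in_polar_frame_iff[OF F, of a] that AB by blast
  ultimately show ?thesis by auto
qed

section \<open>Linear forms defining the hyperplanes, and preservation of lines\<close>

definition polar_form :: "'b \<Rightarrow> 'b \<Rightarrow> 'a" where
  "polar_form x = (SOME g. linear_form g \<and> (\<forall>v. g v = 0 \<longleftrightarrow> v \<in> polar x))"

lemma polar_form:
  assumes "x \<noteq> 0"
  shows linear_form_polar_form: "linear_form (polar_form x)"
    and polar_form_eq_0_iff: "polar_form x v = 0 \<longleftrightarrow> v \<in> polar x"
proof -
  obtain B where B: "is_basis B" "{x} \<subseteq> B" using extend_to_basis[of "{x}"] assms by auto
  obtain B' \<sigma> where F: "frame B B' \<sigma>" using ex_frame B(1) .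
  have "linear_form (\<lambda>v. representation B' v (\<sigma> x))"
    using frameD(2)[OF F] by (simp add: linear_form_def representation_basis_add representation_basis_scale)
  then have "\<exists>g. linear_form g \<and> (\<forall>v. g v = 0 \<longleftrightarrow> v \<in> polar x)"
    using in_polar_frame_iff[OF F, of x] B(2) by auto
  from someI_ex[OF this]
  show "linear_form (polar_form x)" "polar_form x v = 0 \<longleftrightarrow> v \<in> polar x"
    by (auto simp: polar_form_def)
qed

text \<open>The form of \<open>y\<close> is a multiple of the form of \<open>x\<close>, and the
  factor is nonzero because \<open>\<sigma> y\<close> lies outside \<open>polar y\<close> for any
  frame through \<open>y\<close>.\<close>

lemma polar_subset_eq:
  assumes "x \<noteq> 0" "y \<noteq> 0" "polar x \<subseteq> polar y"
  shows "polar x = polar y"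
proof -
  obtain c where c: "\<forall>v. polar_form y v = c * polar_form x v"
    using linear_form_kernel_subset[OF linear_form_polar_form linear_form_polar_form, OF assms(1,2)]
      polar_form_eq_0_iff assms by blast
  obtain B where B: "is_basis B" "{y} \<subseteq> B" using extend_to_basis[of "{y}"] assms by auto
  obtain B' \<sigma> where F: "frame B B' \<sigma>" using ex_frame B(1) .
  have "\<sigma> y \<in> B'" using frameD(4)[OF F] B by blast
  then have "\<sigma> y \<notin> polar y" using in_polar_frame_iff[OF F, of y] B representation_basis_base[OF frameD(2)[OF F]] by auto
  then have "c \<noteq> 0" using c polar_form_eq_0_iff[OF assms(2)] by auto
  then show ?thesis using c polar_form_eq_0_iff[OF assms(1)] polar_form_eq_0_iff[OF assms(2)] by auto
qed

lemma polar_scale: "c \<noteq> 0 \<Longrightarrow> polar (c *s x) = polar x"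
proof -
  assume c: "c \<noteq> 0"
  have "c *s x \<in> U \<longleftrightarrow> x \<in> U" if "U \<in> grassmannian k" for U
  proof
    assume "c *s x \<in> U"
    then have "inverse c *s (c *s x) \<in> U" using that subspace_scale by (auto simp: grassmannian_def simp del: scale_scale)
    then show "x \<in> U" using c by simp
  qed (use that subspace_scale in \<open>auto simp: grassmannian_def\<close>)
  then have "{U \<in> grassmannian k. c *s x \<in> U} = {U \<in> grassmannian k. x \<in> U}" by blast
  then show ?thesis by (simp add: polar_def)
qed


text \<open>With k \<ge> 2 there are k-subspaces through both \<open>x\<close> and \<open>y\<close>,
  and these contain \<open>z\<close>. Their images lie in \<open>polar z\<close> and already span
  \<open>polar x \<inter> polar y\<close>.\<close>

lemma polar_line_2:
  assumes k2: "2 \<le> k" and xy: "indep2 x y" and z: "z = a *s x + b *s y"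
  shows "polar x \<inter> polar y \<subseteq> polar z"
proof
  fix v assume v: "v \<in> polar x \<inter> polar y"
  obtain B where B: "is_basis B" "{x, y} \<subseteq> B"
    using extend_to_basis[OF indep2_independent(2)[OF xy]] .
  obtain B' \<sigma> where F: "frame B B' \<sigma>" using ex_frame B(1) .
  have im: "\<sigma> ` {x, y} \<subseteq> B'" by (rule frame_image[OF F B(2)])
  have "representation B' v (\<sigma> x) = 0" "representation B' v (\<sigma> y) = 0"
    using v in_polar_frame_iff[OF F] B(2) by auto
  then have "v \<in> span (B' - \<sigma> ` {x, y})"
    using in_span_subset_iff[OF frameD(2)[OF F], of "B' - \<sigma> ` {x, y}" v] im by (simp add: double_diff)
  also have "\<dots> = span (\<Union>A\<in>{A \<in> ksubsets k B. {x, y} \<subseteq> A \<and> A \<inter> {} = {}}. f (span A))"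
    by (rule span_images_frame[OF F B(2), symmetric]) (use k2 k indep2_independent(1)[OF xy] in auto)
  also have "\<dots> \<subseteq> polar z"
  proof (rule span_minimal)
    show "(\<Union>A\<in>{A \<in> ksubsets k B. {x, y} \<subseteq> A \<and> A \<inter> {} = {}}. f (span A)) \<subseteq> polar z"
    proof
      fix u assume "u \<in> (\<Union>A\<in>{A \<in> ksubsets k B. {x, y} \<subseteq> A \<and> A \<inter> {} = {}}. f (span A))"
      then obtain A where A: "A \<in> ksubsets k B" "x \<in> A" "y \<in> A" "u \<in> f (span A)" by blast
      have "span A \<in> grassmannian k"
        using coordinate_subspaces_subset[OF B(1), of k] A(1) by (auto simp: coordinate_subspaces_def)
      moreover have "z \<in> span A" unfolding z using A by (simp add: span_add span_scale span_base)
      ultimately show "u \<in> polar z" using f_subset_polar A(4) by blast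
    qed
  qed (simp add: polar_def)
  finally show "v \<in> polar z" .
qed

lemma polar_inj_1:
  assumes k1: "k = 1" and xy: "x \<noteq> 0" "y \<noteq> 0" "polar x = polar y"
  shows "span {x} = span {y}"
proof -
  have f: "f (span {u}) = polar u" "span {u} \<in> grassmannian k" if "u \<noteq> 0" for u
  proof -
    have "independent {u}" using that by simp
    then obtain B where B: "is_basis B" "{u} \<subseteq> B" by (rule extend_to_basis)
    then have u: "{u} \<in> ksubsets k B" using k1 by (simp add: ksubsets_def)
    show "f (span {u}) = polar u" using f_span_eq[OF B(1) u] by simp
    show "span {u} \<in> grassmannian k"
      using coordinate_subspaces_subset[OF B(1), of k] u by (auto simp: coordinate_subspaces_def)
  qed
  have "inj_on f (grassmannian k)" using regular by (simp add: regular_bijection_def bij_betw_def)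
  then show ?thesis using f xy by (metis inj_onD)
qed

text \<open>For \<open>k = 1\<close> the basis is sheared along \<open>c\<close> so that the polars of \<open>x\<close>, \<open>y\<close>, \<open>z\<close> become
  three different coordinate hyperplanes; by regularity of the inverse, \<open>x\<close>, \<open>y\<close>, \<open>z\<close> would then be
  proportional to three members of a basis.\<close>

lemma polar_line_1:
  assumes k1: "k = 1" and xy: "indep2 x y" and z: "z = a *s x + b *s y" "z \<noteq> 0"
  shows "polar x \<inter> polar y \<subseteq> polar z"
proof (rule ccontr)
  assume "\<not> polar x \<inter> polar y \<subseteq> polar z"
  then obtain v where v: "v \<in> polar x" "v \<in> polar y" "v \<notin> polar z" by blast
  have x0: "x \<noteq> 0" and y0: "y \<noteq> 0" using indep2_nonzero[OF xy] by simp_all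
  obtain B where B: "is_basis B" "{x, y} \<subseteq> B"
    using extend_to_basis[OF indep2_independent(2)[OF xy]] .
  obtain B' \<sigma> where F: "frame B B' \<sigma>" using ex_frame B(1) .
  have B': "is_basis B'" using frameD(2)[OF F] .
  have finB': "finite B'" using is_basis_finite[OF B'] .
  have im: "\<sigma> ` {x, y} \<subseteq> B'" by (rule frame_image[OF F B(2)])
  have sub_polar: "subspace (polar u)" for u by (simp add: polar_def)
  have "representation B' v (\<sigma> x) = 0" "representation B' v (\<sigma> y) = 0"
    using v in_polar_frame_iff[OF F] B(2) by auto
  then have vs: "v \<in> span (B' - \<sigma> ` {x, y})"
    using in_span_subset_iff[OF B', of "B' - \<sigma> ` {x, y}" v] im by (simp add: double_diff)
  \<comment> \<open>\<open>polar x \<inter> polar y\<close> is spanned by the basis vectors other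
    than \<open>\<sigma> x\<close> and \<open>\<sigma> y\<close>, so one of these is already outside
    \<open>polar z\<close>.\<close>
  have "\<exists>c\<in>B' - \<sigma> ` {x, y}. c \<notin> polar z"
  proof (rule ccontr)
    assume "\<not> (\<exists>c\<in>B' - \<sigma> ` {x, y}. c \<notin> polar z)"
    then have "B' - \<sigma> ` {x, y} \<subseteq> polar z" by blast
    then have "span (B' - \<sigma> ` {x, y}) \<subseteq> polar z" using sub_polar by (rule span_minimal)
    then show False using vs v(3) by blast
  qed
  then obtain c where c: "c \<in> B'" "c \<noteq> \<sigma> x" "c \<noteq> \<sigma> y" "c \<notin> polar z" by blast
  define g where "g = polar_form z"
  have g: "linear_form g" "\<And>v. g v = 0 \<longleftrightarrow> v \<in> polar z"
    using polar_form[OF z(2)] by (simp_all add: g_def)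
  have gc: "g c \<noteq> 0" using g(2) c(4) by simp
  \<comment> \<open>Projection along \<open>c\<close> onto \<open>polar z\<close>. As
    \<open>c\<close> lies in \<open>polar x\<close> and \<open>polar y\<close>, it maps each of
    these two hyperplanes into itself.\<close>
  define m where "m u = u - (g u / g c) *s c" for u
  have gm: "m u \<in> polar z" for u
  proof -
    have "g (m u) = 0" unfolding m_def linear_form_diff[OF g(1)] using g(1) gc by (simp add: linear_form_def)
    then show ?thesis using g(2) by simp
  qed
  define C where "C = insert c (m ` (B' - {c}))"
  have "B' \<subseteq> span C"
  proof
    fix u assume u: "u \<in> B'"
    have cC: "c \<in> span C" by (rule span_base) (simp add: C_def)
    show "u \<in> span C"
    proof (cases "u = c")
      case False
      then have "m u \<in> span C" using u by (intro span_base) (simp add: C_def)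
      then have "m u + (g u / g c) *s c \<in> span C" using cC by (intro span_add span_scale)
      then show ?thesis by (simp add: m_def)
    qed (use cC in simp)
  qed
  then have "span B' \<subseteq> span C" by (simp add: span_minimal)
  then have "span C = UNIV" using is_basis_span[OF B'] by (simp add: top.extremum_unique)
  moreover have "card C \<le> dimension"
  proof -
    have "card C \<le> Suc (card (m ` (B' - {c})))" by (simp add: C_def card_insert_if finB')
    also have "\<dots> \<le> Suc (card (B' - {c}))" using card_image_le[of "B' - {c}" m] finB' by simp
    also have "\<dots> = dimension" using card_Suc_Diff1[OF finB' c(1)] is_basis_card[OF B'] by simp
    finally show ?thesis .
  qed
  ultimately have C: "is_basis C" using finB' by (intro spanning_is_basis) (simp_all add: C_def)
  obtain E \<tau> where E: "frame E C \<tau>" using ex_coframe C .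
  \<comment> \<open>A basis vector \<open>w\<close> of the coframe has \<open>polar w\<close>
    spanned by \<open>C - {\<tau> w}\<close>. Hence whenever \<open>polar u\<close> is a coordinate
    hyperplane of \<open>C\<close>, injectivity of \<open>f\<close> on points makes \<open>u\<close>
    proportional to a member of \<open>E\<close>.\<close>
  have match: "\<exists>w\<in>E. \<tau> w = d \<and> span {w} = span {u}"
    if d: "d \<in> C" "C - {d} \<subseteq> polar u" and u: "u \<noteq> 0" for d u
  proof -
    obtain w where w: "w \<in> E" "\<tau> w = d" using d(1) frameD(4)[OF E] by auto
    have w0: "w \<noteq> 0" using basis_nonzero[OF frameD(1)[OF E] w(1)] .
    have "polar w \<subseteq> polar u" unfolding polar_frame[OF E w(1)] w(2)
      by (rule span_minimal[OF d(2) sub_polar])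
    then have "polar w = polar u" using polar_subset_eq w0 u by blast
    then show ?thesis using polar_inj_1[OF k1 w0 u] w by blast
  qed
  have base: "u \<in> polar b" if "b \<in> {x, y}" "u \<in> B'" "u \<noteq> \<sigma> b" for u b
    using in_polar_frame_iff[OF F, of b u] that B(2) representation_basis_base[OF B' that(2)] by auto
  have mC: "m (\<sigma> b) \<in> C" "C - {m (\<sigma> b)} \<subseteq> polar b" if b: "b \<in> {x, y}" for b
  proof -
    have bc: "\<sigma> b \<in> B' - {c}" using im b c(2,3) by auto
    then show "m (\<sigma> b) \<in> C" by (simp add: C_def)
    have cb: "c \<in> polar b" using base[OF b c(1)] c(2,3) b by auto
    show "C - {m (\<sigma> b)} \<subseteq> polar b"
    proof
      fix u assume "u \<in> C - {m (\<sigma> b)}"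
      then consider "u = c" | t where "t \<in> B'" "t \<noteq> \<sigma> b" "u = m t" by (auto simp: C_def)
      then show "u \<in> polar b"
      proof cases
        case 2
        have "t \<in> polar b" using base[OF b 2(1,2)] .
        then show ?thesis unfolding 2(3) m_def
          using cb by (intro subspace_diff subspace_scale sub_polar)
      qed (use cb in simp)
    qed
  qed
  obtain wx where wx: "wx \<in> E" "\<tau> wx = m (\<sigma> x)" "span {wx} = span {x}"
    using match[OF mC[of x] x0] by auto
  obtain wy where wy: "wy \<in> E" "\<tau> wy = m (\<sigma> y)" "span {wy} = span {y}"
    using match[OF mC[of y] y0] by auto
  have "c \<in> C" "C - {c} \<subseteq> polar z" using gm by (auto simp: C_def)
  then obtain wz where wz: "wz \<in> E" "\<tau> wz = c" "span {wz} = span {z}"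
    using match[of c z] z(2) by auto
  have "c \<noteq> m u" for u using gm[of u] c(4) by auto
  then have ne: "wz \<noteq> wx" "wz \<noteq> wy" using wx wy wz by auto
  have "x \<in> span {wx}" "y \<in> span {wy}" using wx(3) wy(3) span_base[of x "{x}"] span_base[of y "{y}"] by auto
  then have "x \<in> span {wx, wy}" "y \<in> span {wx, wy}"
    using span_mono[of "{wx}" "{wx, wy}"] span_mono[of "{wy}" "{wx, wy}"] by auto
  then have "z \<in> span {wx, wy}" unfolding z(1) by (intro span_add span_scale)
  then have "span {z} \<subseteq> span {wx, wy}" by (simp add: span_minimal)
  then have "span {wz} \<subseteq> span {wx, wy}" using wz(3) by simp
  then have "{wz} \<subseteq> {wx, wy}"
    using span_subset_iff[OF frameD(1)[OF E], of "{wz}" "{wx, wy}"] wx(1) wy(1) wz(1) by simp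
  then show False using ne by simp
qed

lemma polar_form_line:
  assumes "x \<noteq> 0" "y \<noteq> 0" "a *s x + b *s y \<noteq> 0"
  shows "\<exists>c d. \<forall>v. polar_form (a *s x + b *s y) v = c * polar_form x v + d * polar_form y v"
proof -
  let ?z = "a *s x + b *s y"
  have "polar x \<inter> polar y \<subseteq> polar ?z"
  proof (cases "indep2 x y")
    case True
    show ?thesis
    proof (cases "k = 1")
      case k1: True
      show ?thesis by (rule polar_line_1[OF k1 True refl assms(3)])
    next
      case False
      then show ?thesis using polar_line_2[OF _ True refl] k by simp
    qed
  next
    case False
    then obtain c where "y = c *s x" using not_indep2E assms(1) by blast
    then have z: "?z = (a + b * c) *s x" by (simp add: scale_left_distrib)
    then have "a + b * c \<noteq> 0" using assms(3) by auto
    then have "polar ?z = polar x" unfolding z by (rule polar_scale)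
    then show ?thesis by simp
  qed
  then show ?thesis
    using linear_form_kernel_Int_subset[OF linear_form_polar_form[OF assms(1)] linear_form_polar_form[OF assms(2)]
      linear_form_polar_form[OF assms(3)]] polar_form_eq_0_iff assms by blast
qed

text \<open>A basis of the kernel of \<open>g\<close> together with \<open>v\<close> is prescribed
  on the target side; the source vector \<open>z\<close> with \<open>\<sigma> z = v\<close> has
  exactly this kernel as its polar.\<close>

lemma polar_form_onto:
  assumes g: "linear_form g" "g v \<noteq> 0"
  shows "\<exists>z d. z \<noteq> 0 \<and> (\<forall>u. g u = d * polar_form z u)"
proof -
  let ?H = "{u. g u = 0}"
  have "g 0 = 0" using linear_form_diff[OF g(1), of 0 0] by simp
  then have sub: "subspace ?H" using g(1) by (simp add: subspace_def linear_form_def)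
  obtain C where C: "C \<subseteq> ?H" "independent C" "?H \<subseteq> span C"
    using maximal_independent_subset by blast
  then have sC: "span C = ?H" using span_minimal[OF C(1) sub] by blast
  then have v: "v \<notin> span C" using g(2) by simp
  have "u \<in> span (insert v C)" for u
  proof -
    have "u - (g u / g v) *s v \<in> ?H" using g by (simp add: linear_form_diff) (simp add: linear_form_def)
    then show ?thesis using sC by (auto simp: span_insert)
  qed
  then have "is_basis (insert v C)" unfolding is_basis_def using independent_insertI[OF v C(2)] by blast
  then obtain B \<sigma> where F: "frame B (insert v C) \<sigma>" using ex_coframe by blast
  have "v \<in> \<sigma> ` B" by (simp add: frameD(4)[OF F])
  then obtain z where z: "z \<in> B" "\<sigma> z = v" by blast
  have z0: "z \<noteq> 0" using basis_nonzero[OF frameD(1)[OF F] z(1)] .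
  have "v \<notin> C" using v span_base by blast
  then have "polar z = ?H" using polar_frame[OF F z(1)] z(2) sC by simp
  then show ?thesis
    using linear_form_kernel_subset[OF linear_form_polar_form[OF z0] g(1)] polar_form_eq_0_iff[OF z0] z0 by blast
qed

text \<open>In a frame through the three points, evaluating their forms at
  \<open>\<sigma> x\<close>, \<open>\<sigma> y\<close>, \<open>\<sigma> z\<close> gives a diagonal
  matrix with nonzero diagonal.\<close>

lemma polar_form_indep3:
  assumes "indep3 x y z" "\<And>v. a * polar_form x v + b * polar_form y v + c * polar_form z v = 0"
  shows "a = 0 \<and> b = 0 \<and> c = 0"
proof -
  note i = indep3_independent[OF assms(1)] and nz = indep3_nonzero[OF assms(1)]
  obtain B where B: "is_basis B" "{x, y, z} \<subseteq> B" using extend_to_basis[OF i(4)] .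
  obtain B' \<sigma> where F: "frame B B' \<sigma>" using ex_frame B(1) .
  have pf: "polar_form s (\<sigma> t) = 0 \<longleftrightarrow> s \<noteq> t" if "s \<in> {x, y, z}" "t \<in> {x, y, z}" for s t
  proof -
    have st: "s \<in> B" "t \<in> B" "s \<noteq> 0" using that B(2) nz by auto
    then have "\<sigma> t \<in> B'" using frameD(4)[OF F] by auto
    then have "\<sigma> t \<in> polar s \<longleftrightarrow> \<sigma> s \<noteq> \<sigma> t"
      using in_polar_frame_iff[OF F st(1), of "\<sigma> t"] representation_basis_base[OF frameD(2)[OF F]] by simp
    then show ?thesis using polar_form_eq_0_iff[OF st(3)] inj_on_eq_iff[OF frameD(3)[OF F] st(1,2)] by simp
  qed
  show ?thesis
    using assms(2)[of "\<sigma> x"] assms(2)[of "\<sigma> y"] assms(2)[of "\<sigma> z"] i(1-3)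
      pf[of x x] pf[of x y] pf[of x z] pf[of y x] pf[of y y] pf[of y z] pf[of z x] pf[of z y] pf[of z z]
    by auto
qed

theorem ex_form:
  "\<exists>\<Omega>. sesquilinear_form \<Omega> \<and> nondegenerate_form \<Omega> \<and>
     (\<forall>U\<in>grassmannian k. f U = orthogonal_complement \<Omega> U)"
proof -
  let ?s = "\<lambda>(c::'a) (g::'b \<Rightarrow> 'a) v. c * g v"
  interpret W: vector_space ?s by (rule vector_space_fun)
  interpret projective_collineation scale ?s polar_form
  proof unfold_locales
    show "\<exists>c d. polar_form (a *s x + b *s y) = ?s c (polar_form x) + ?s d (polar_form y)"
      if "x \<noteq> 0" "y \<noteq> 0" "a *s x + b *s y \<noteq> 0" for x y a b
      using polar_form_line[OF that] by (simp add: fun_eq_iff)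
    show "W.indep3 (polar_form x) (polar_form y) (polar_form z)" if "indep3 x y z" for x y z
      unfolding W.indep3_def
    proof (intro allI impI)
      fix a b c assume "?s a (polar_form x) + ?s b (polar_form y) + ?s c (polar_form z) = 0"
      from fun_cong[OF this]
      have "a * polar_form x v + b * polar_form y v + c * polar_form z v = 0" for v by simp
      then show "a = 0 \<and> b = 0 \<and> c = 0" by (rule polar_form_indep3[OF that])
    qed
    show "\<exists>z d. z \<noteq> 0 \<and> polar_form x + ?s c (polar_form y) = ?s d (polar_form z)" if xy: "indep2 x y" for x y c
    proof -
      \<comment> \<open>The third vector serves to apply \<open>polar_form_indep3\<close>: the
        combination has first coefficient 1, so it is not the zero form.\<close>
      obtain z where z: "indep3 x y z" using ex_indep3[OF dim3 xy] by blast
      let ?g = "\<lambda>v. polar_form x v + c * polar_form y v"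
      have "\<exists>v. ?g v \<noteq> 0" using polar_form_indep3[OF z, of 1 c 0] by auto
      moreover have "linear_form ?g"
        using linear_form_polar_form indep2_nonzero[OF xy] by (simp add: linear_form_def algebra_simps)
      ultimately show ?thesis using polar_form_onto[of ?g] by (auto simp: fun_eq_iff)
    qed
    show "\<exists>y. indep2 x y" if "x \<noteq> 0" for x using ex_indep2[OF dim3 that] .
    show "\<exists>z. indep3 x y z" if "indep2 x y" for x y using ex_indep3[OF dim3 that] .
  qed
  obtain B where B: "is_basis B" using extend_to_basis[OF independent_empty] by blast
  have "B \<noteq> {}" using is_basis_card[OF B] k by auto
  then obtain e :: 'b where "e \<noteq> 0" using basis_nonzero[OF B] by blast
  then obtain \<mu> \<phi> where phi: "field_automorphism \<phi>"
    and mu: "\<And>x y. \<mu> (x + y) = \<mu> x + \<mu> y" "\<And>a x. \<mu> (a *s x) = ?s (\<phi> a) (\<mu> x)"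
      "\<And>x. x \<noteq> 0 \<Longrightarrow> \<exists>c. c \<noteq> 0 \<and> \<mu> x = ?s c (polar_form x)"
    by (rule semilinear_lift) blast
  have mu0: "\<mu> 0 v = 0" for v
  proof -
    have "\<mu> 0 v + \<mu> 0 v = \<mu> 0 v + 0"
      using fun_cong[OF mu(1)[of 0 0], of v] by (simp only: add_0_right plus_fun_apply)
    then show ?thesis by (simp only: add_left_cancel)
  qed
  have mu_iff: "\<mu> x v = 0 \<longleftrightarrow> v \<in> polar x" if "x \<noteq> 0" for x v
    using mu(3)[OF that] polar_form_eq_0_iff[OF that, of v] by auto
  have mu_lin: "linear_form (\<mu> x)" for x
  proof (cases "x = 0")
    case True
    then show ?thesis by (simp add: linear_form_def mu0)
  next
    case False
    then show ?thesis using mu(3)[OF False] linear_form_polar_form[OF False]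
      by (auto simp: linear_form_def algebra_simps)
  qed
  obtain \<psi> where psi_auto: "field_automorphism \<psi>"
    and psi_phi: "\<And>a. \<psi> (\<phi> a) = a" and psi0: "\<And>a. \<psi> a = 0 \<longleftrightarrow> a = 0"
    by (rule field_automorphism_inverse[OF phi]) blast
  note psi = field_automorphismD[OF psi_auto]
  \<comment> \<open>\<open>\<mu> x y\<close> is twisted by \<open>\<phi>\<close> in \<open>x\<close>
    and linear in \<open>y\<close>. Applying the inverse \<open>\<psi>\<close> moves the twist to
    the second variable, as the definition of a sesquilinear form demands, without changing its
    zeros.\<close>
  define \<Omega> where "\<Omega> x y = \<psi> (\<mu> x y)" for x y
  have Om0: "\<Omega> x y = 0 \<longleftrightarrow> x = 0 \<or> y \<in> polar x" for x y
    using mu_iff[of x y] mu0 by (auto simp: \<Omega>_def psi0)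
  have "sesquilinear_form \<Omega>" unfolding sesquilinear_form_def
  proof (intro conjI allI exI[of _ \<psi>])
    show "\<Omega> (x + y) z = \<Omega> x z + \<Omega> y z" for x y z by (simp add: \<Omega>_def mu(1) psi)
    show "\<Omega> x (y + z) = \<Omega> x y + \<Omega> x z" for x y z
      using mu_lin[of x] by (simp add: \<Omega>_def linear_form_def psi)
    show "\<Omega> (a *s x) (b *s y) = a * \<psi> b * \<Omega> x y" for a b x y
      using mu_lin[of x] by (simp add: \<Omega>_def linear_form_def psi mu(2) psi_phi mult.assoc)
  qed (rule psi_auto)
  moreover have "nondegenerate_form \<Omega>" unfolding nondegenerate_form_def
  proof (intro conjI allI impI)
    fix x assume *: "\<forall>y. \<Omega> x y = 0"
    show "x = 0"
    proof (rule ccontr)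
      assume x: "x \<noteq> 0"
      then obtain y z where "indep3 x y z" using ex_indep2 ex_indep3 by blast
      moreover have "polar_form x v = 0" for v using * x Om0 polar_form_eq_0_iff by blast
      ultimately show False using polar_form_indep3[of x y z 1 0 0] by simp
    qed
  next
    fix y assume *: "\<forall>x. \<Omega> x y = 0"
    obtain B' \<sigma> where F: "frame B B' \<sigma>" using ex_frame B .
    have "representation B' y b' = 0" if b': "b' \<in> B'" for b'
    proof -
      obtain b where b: "b \<in> B" "b' = \<sigma> b" using b' frameD(4)[OF F] by auto
      then have "y \<in> polar b" using * Om0 basis_nonzero[OF B b(1)] by blast
      then show ?thesis using in_polar_frame_iff[OF F b(1)] b(2) by simp
    qed
    then have "y \<in> span {}" using in_span_subset_iff[OF frameD(2)[OF F], of "{}" y] by simp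
    then show "y = 0" by simp
  qed
  moreover have "f U = orthogonal_complement \<Omega> U" if U: "U \<in> grassmannian k" for U
  proof -
    obtain A C where A: "is_basis C" "A \<in> ksubsets k C" "U = span A"
      using grassmannian_basis[OF U independent_empty] by blast
    have fU: "f U = (\<Inter>a\<in>A. polar a)" using f_span_eq[OF A(1,2)] A(3) by simp
    show ?thesis
    proof
      show "f U \<subseteq> orthogonal_complement \<Omega> U"
        using f_subset_polar[OF U] Om0 by (auto simp: orthogonal_complement_def)
      show "orthogonal_complement \<Omega> U \<subseteq> f U"
      proof
        fix y assume y: "y \<in> orthogonal_complement \<Omega> U"
        have "y \<in> polar a" if a: "a \<in> A" for a
        proof -
          have "a \<in> C" using a A(2) by (auto simp: ksubsets_def)
          then have "a \<noteq> 0" using basis_nonzero[OF A(1)] by blast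
          moreover have "a \<in> U" using a A(3) span_base by simp
          ultimately show ?thesis using y Om0 by (auto simp: orthogonal_complement_def)
        qed
        then show "y \<in> f U" using fU by simp
      qed
    qed
  qed
  ultimately show ?thesis by blast
qed

end

section \<open>The case 2k > n by duality, and the theorem for a general vector space\<close>

context finite_dimensional_vector_space
begin

text \<open>Swapping the arguments puts the twist \<open>\<phi>\<close> on the first variable;
  composing with its inverse makes that variable linear again and twists the second by
  \<open>\<psi>\<close>.\<close>

lemma sesquilinear_form_transpose:
  assumes "sesquilinear_form \<Omega>" "nondegenerate_form \<Omega>"
  obtains \<Omega>' where "sesquilinear_form \<Omega>'" "nondegenerate_form \<Omega>'"
    "\<And>x y. \<Omega>' x y = 0 \<longleftrightarrow> \<Omega> y x = 0"
proof -
  obtain \<phi> where phi: "field_automorphism \<phi>"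
    and Om: "\<And>a b x y. \<Omega> (a *s x) (b *s y) = a * \<phi> b * \<Omega> x y"
    and Om_add: "\<And>x y z. \<Omega> (x + y) z = \<Omega> x z + \<Omega> y z" "\<And>x y z. \<Omega> x (y + z) = \<Omega> x y + \<Omega> x z"
    using assms(1) by (auto simp: sesquilinear_form_def)
  obtain \<psi> where psi: "field_automorphism \<psi>" and psi_phi: "\<And>a. \<psi> (\<phi> a) = a" and psi0: "\<And>a. \<psi> a = 0 \<longleftrightarrow> a = 0"
    using field_automorphism_inverse[OF phi] by blast
  note psi_hom = field_automorphismD[OF psi]
  define \<Omega>' where "\<Omega>' x y = \<psi> (\<Omega> y x)" for x y
  have iff: "\<Omega>' x y = 0 \<longleftrightarrow> \<Omega> y x = 0" for x y by (simp add: \<Omega>'_def psi0)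
  have "sesquilinear_form \<Omega>'" unfolding sesquilinear_form_def
  proof (intro conjI allI exI[of _ \<psi>])
    show "\<Omega>' (a *s x) (b *s y) = a * \<psi> b * \<Omega>' x y" for a b x y
      by (simp add: \<Omega>'_def Om psi_hom psi_phi mult_ac)
  qed (simp_all add: \<Omega>'_def Om_add psi_hom psi)
  moreover have "nondegenerate_form \<Omega>'"
    using assms(2) unfolding nondegenerate_form_def iff by blast
  ultimately show ?thesis using iff by (rule that)
qed

lemma subspace_sesquilinear_kernel:
  assumes "sesquilinear_form \<Omega>"
  shows "subspace {w. \<Omega> w x = 0}"
proof -
  obtain \<phi> where phi: "field_automorphism \<phi>"
    and Om: "\<And>a b x y. \<Omega> (a *s x) (b *s y) = a * \<phi> b * \<Omega> x y"
    and add: "\<And>x y z. \<Omega> (x + y) z = \<Omega> x z + \<Omega> y z"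
    using assms by (auto simp: sesquilinear_form_def)
  have scale: "\<Omega> (a *s w) x = a * \<Omega> w x" for a w
    using Om[of a w 1 x] field_automorphismD(3)[OF phi] by simp
  have "\<Omega> 0 x = 0" using scale[of 0 0] by simp
  then show ?thesis by (simp add: subspace_def add scale)
qed

text \<open>One basis vector of \<open>W\<close> is traded for \<open>y\<close>. The competitor
  \<open>W'\<close> takes the place of a dimension formula for orthogonal complements in the case 2k
  > n.\<close>

lemma grassmannian_exchange:
  assumes W: "W \<in> grassmannian m" "1 \<le> m" and y: "y \<notin> W"
  obtains W' where "W' \<in> grassmannian m" "W' \<noteq> W" "W' \<subseteq> span (insert y W)"
proof -
  obtain A B where A: "is_basis B" "A \<in> ksubsets m B" "W = span A"
    using grassmannian_basis[OF W(1) independent_empty] by blast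
  have AB: "A \<subseteq> B" "card A = m" using A(2) by (simp_all add: ksubsets_def)
  have fin: "finite A" using AB(1) is_basis_finite[OF A(1)] finite_subset by blast
  obtain a where a: "a \<in> A" using AB(2) W(2) by fastforce
  let ?A = "insert y (A - {a})"
  have "independent A" using is_basis_independent[OF A(1)] AB(1) independent_mono by blast
  then have iA: "independent (A - {a})" using independent_mono by blast
  have "y \<notin> span (A - {a})" using y A(3) span_mono[of "A - {a}" A] by blast
  then have ind: "independent ?A" using iA by (rule independent_insertI)
  have "y \<notin> A" using y A(3) span_base by blast
  then have "card ?A = m" using card_Suc_Diff1[OF fin a] AB(2) fin by (simp add: card_insert_if)
  then have "span ?A \<in> grassmannian m"
    using dim_span_eq_card_independent[OF ind] by (simp add: grassmannian_def)
  moreover have "span ?A \<noteq> W" using y span_base[of y ?A] by blast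
  moreover have "span ?A \<subseteq> span (insert y W)"
    using A(3) span_superset[of A] by (intro span_mono) blast
  ultimately show ?thesis by (rule that)
qed

theorem regular_bijection_form:
  assumes f: "regular_bijection k (dimension - k) f"
    and k: "1 \<le> k" "k \<le> dimension - 1" "dimension \<noteq> 2 * k"
  shows "\<exists>\<Omega>. sesquilinear_form \<Omega> \<and> nondegenerate_form \<Omega> \<and>
    (\<forall>U\<in>grassmannian k. f U = orthogonal_complement \<Omega> U)"
proof (cases "2 * k < dimension")
  case True
  then interpret regular_duality scale Basis k f by unfold_locales (use f k in auto)
  show ?thesis by (rule ex_form)
next
  case False
  let ?l = "dimension - k" and ?g = "inv_into (grassmannian k) f"
  have kn: "dimension - ?l = k" using k by linarith
  have bij: "bij_betw f (grassmannian k) (grassmannian ?l)"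
    using f by (simp add: regular_bijection_def)
  have g: "regular_bijection ?l (dimension - ?l) ?g" unfolding kn by (rule regular_bijection_inv[OF f])
  have l: "1 \<le> ?l" "2 * ?l < dimension" using k False by linarith+
  interpret regular_duality scale Basis ?l ?g by unfold_locales (rule g l)+
  obtain \<Omega> where Om: "sesquilinear_form \<Omega>" "nondegenerate_form \<Omega>"
    and perp: "\<And>W. W \<in> grassmannian ?l \<Longrightarrow> ?g W = orthogonal_complement \<Omega> W"
    using ex_form by blast
  obtain \<Omega>' where Om': "sesquilinear_form \<Omega>'" "nondegenerate_form \<Omega>'"
    and iff: "\<And>x y. \<Omega>' x y = 0 \<longleftrightarrow> \<Omega> y x = 0"
    using sesquilinear_form_transpose[OF Om] by blast
  have "f U = orthogonal_complement \<Omega>' U" if U: "U \<in> grassmannian k" for U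
  proof
    have fU: "f U \<in> grassmannian ?l" using bij U by (rule bij_betw_apply)
    have "?g (f U) = U" using bij_betw_inv_into_left[OF bij U] .
    then have Ueq: "U = orthogonal_complement \<Omega> (f U)" using perp[OF fU] by simp
    then show "f U \<subseteq> orthogonal_complement \<Omega>' U" by (auto simp: orthogonal_complement_def iff)
    show "orthogonal_complement \<Omega>' U \<subseteq> f U"
    proof
      fix y assume y: "y \<in> orthogonal_complement \<Omega>' U"
      show "y \<in> f U"
      proof (rule ccontr)
        assume "y \<notin> f U"
        \<comment> \<open>Since \<open>y\<close> and \<open>f U\<close> are both orthogonal to
          \<open>U\<close>, so is \<open>W\<close>. Hence \<open>U\<close> is contained in
          \<open>?g W\<close>, which has the same dimension, and injectivity of \<open>?g\<close>
          contradicts \<open>W \<noteq> f U\<close>.\<close>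
        then obtain W where W: "W \<in> grassmannian ?l" "W \<noteq> f U" "W \<subseteq> span (insert y (f U))"
          by (rule grassmannian_exchange[OF fU l(1)])
        have "\<Omega> w x = 0" if x: "x \<in> U" and w: "w \<in> W" for w x
        proof -
          have "insert y (f U) \<subseteq> {w. \<Omega> w x = 0}"
            using x y Ueq by (auto simp: orthogonal_complement_def iff)
          then have "span (insert y (f U)) \<subseteq> {w. \<Omega> w x = 0}"
            by (rule span_minimal) (rule subspace_sesquilinear_kernel[OF Om(1)])
          then show ?thesis using w W(3) by blast
        qed
        then have "U \<subseteq> ?g W" unfolding perp[OF W(1)] by (auto simp: orthogonal_complement_def)
        moreover have gW: "?g W \<in> grassmannian k"
          using bij_betw_inv_into[OF bij] W(1) by (rule bij_betw_apply)
        ultimately have "U = ?g W" using U by (intro subspace_dim_equal) (auto simp: grassmannian_def)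
        then have "f U = W" using bij_betw_inv_into_right[OF bij W(1)] by simp
        then show False using W(2) by simp
      qed
    qed
  qed
  then show ?thesis using Om' by blast
qed

end

theorem corollary1p1:
  fixes scale :: "'a::field \<Rightarrow> 'v::ab_group_add \<Rightarrow> 'v"
    and n k :: nat
    and f :: "'v set \<Rightarrow> 'v set"
  assumes "vector_space scale"
    and "vector_space.dim scale UNIV = n"
    and "n \<ge> 3" and "1 \<le> k" and "k \<le> n - 1" and "n \<noteq> 2 * k"
    and "vector_space.regular_bijection scale k (n - k) f"
  shows "\<exists>\<Omega>. vector_space.sesquilinear_form scale \<Omega> \<and>
             nondegenerate_form \<Omega> \<and>
             (\<forall>U\<in>vector_space.grassmannian scale k. f U = orthogonal_complement \<Omega> U)"
proof -
  interpret vector_space scale by fact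
  obtain B where B: "independent B" "UNIV \<subseteq> span B" "card B = dim UNIV"
    by (rule basis_exists[of UNIV])
  \<comment> \<open>An infinite set has \<open>card\<close> 0, so a dimension of at least 3 excludes
    an infinite basis.\<close>
  have fin: "finite B" using B(3) assms(2,3) by (intro card_ge_0_finite) simp
  have sp: "span B = UNIV" using B(2) by blast
  interpret finite_dimensional_vector_space scale B by unfold_locales (rule fin B(1) sp)+
  have n: "dimension = n" using B(3) assms(2) by (simp add: dimension_def)
  show ?thesis by (rule regular_bijection_form) (use assms(4-7) in \<open>simp_all add: n\<close>)
qed

end
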